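(* Let $H$ be an infinite-dimensional separable Hilbert space. Then there is a Borel map $(G,\gamma,\Phi)\mapsto\delta_{(G,\gamma,\Phi)}$ from $\mathrm{Act}_{\Gamma(H)}$ to $\Gamma(H)$ such that $$C^*\left(\delta_{(G,\gamma,\Phi)}\right)\cong C^*(\gamma)\rtimes_{\widehat{\Phi},r}G$$ for every $(G,\gamma,\Phi)\in\mathrm{Act}_{\Gamma(H)}$. In other words, there is a Borel way to compute a code for the reduced crossed product of a separable C*-algebra by an action of a countable discrete group.
   Context: $\mathcal{G}\subseteq\omega^{\omega\times\omega}$ is the Borel set of functions $f\colon\omega\times\omega\to\omega$ such that $n\cdot_f m=f(n,m)$ is a group operation on $\omega$ (the standard Borel space of infinite countable groups). $B_1(H)$ is the unit ball of $B(H)$ with the weak operator topology; $\Gamma(H)=B_1(H)^{\omega}\setminus\{0\}$ with its standard Borel structure. For $\gamma\in\Gamma(H)$, $C^*(\gamma)$ is the C*-subalgebra of $B(H)$ generated by $\{\gamma_n:n\in\omega\}$. $\mathcal{U}$ is the (countable) $\mathbb{Q}(i)$-$*$-algebra of noncommutative $*$-polynomials with coefficients in $\mathbb{Q}(i)$ and no constant term in formal variables $X_k$, $k\in\omega$; for $p\in\mathcal{U}$, $p(\gamma)$ is the evaluation $X_k\mapsto\gamma_k$, $X_k^*\mapsto\gamma_k^*$. For $\gamma,\gamma'\in\Gamma(H)$, a sequence $\Phi=(\Phi_n)_{n\in\omega}\in(\mathcal{U}^{\mathcal{U}})^{\omega}$ is a code for a $*$-homomorphism from $C^*(\gamma)$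 to $C^*(\gamma')$ if (a) the sequence $(\Phi_n(p)(\gamma'))_{n}$ is Cauchy uniformly in $p\in\mathcal{U}$, hence converges to an element $\widehat{\Phi}(p(\gamma))$ of $C^*(\gamma')$; and (b) $p(\gamma)\mapsto\widehat{\Phi}(p(\gamma))$ extends to a $*$-homomorphism $\widehat\Phi\colon C^*(\gamma)\to C^*(\gamma')$. It is a code for an automorphism of $C^*(\gamma)$ if $\gamma=\gamma'$ and $\widehat{\Phi}$ is an automorphism. For $G\in\mathcal{G}$ and $\gamma\in\Gamma(H)$, $\Phi=(\Phi_{m,n})_{(m,n)\in\omega\times\omega}\in(\mathcal{U}^{\mathcal{U}})^{\omega\times\omega}$ is a code for an action of $G$ on $C^*(\gamma)$ if: for every $m\in\omega$, $(\Phi_{m,n})_{n\in\omega}$ is a code for an automorphism $\widehat{\Phi}_m$ of $C^*(\gamma)$; $\Phi_{0,n}(q)=q$ for all $n\in\omega$, $q\in\mathcal{U}$; and $m\mapsto\widehat{\Phi}_m$ is an action $\widehat\Phi$ of $G$ on $C^*(\gamma)$, i.e. $\widehat{\Phi}_m\circ\widehat{\Phi}_k=\widehat{\Phi}_n$ whenever $m\cdot_G k=n$. $\mathrm{Act}_{\Gamma(H)}$ is the Borel set of triples $(G,\gamma,\Phi)\in\mathcal{G}\times\Gamma(H)\times(\mathcal{U}^{\mathcal{U}})^{\omega\times\omega}$ such that $\Phi$ is a code for an action of $G$ on $C^*(\gamma)$. $A\rtimes_{\alpha,r}G$ denotes the reduced crossed product. *)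

theory Defs
  imports
    "HOL-Analysis.Analysis"
    "HOL-Library.Poly_Mapping"
    "HOL-Algebra.Group"
begin

section \<open>Complex Hilbert spaces\<close>

text \<open>
  The norm and metric come from the underlying real Hilbert space, whose inner product is the
  real part of the complex one. The complex inner product is linear in its first argument.
\<close>

class chilbert_space = real_inner + complete_space +
  fixes scaleC :: "complex \<Rightarrow> 'a \<Rightarrow> 'a"  (infixr \<open>*\<^sub>C\<close> 75)
    and cinner :: "'a \<Rightarrow> 'a \<Rightarrow> complex"
  assumes scaleC_add_right: "c *\<^sub>C (x + y) = c *\<^sub>C x + c *\<^sub>C y"
    and scaleC_add_left: "(c + d) *\<^sub>C x = c *\<^sub>C x + d *\<^sub>C x"
    and scaleC_scaleC: "c *\<^sub>C (d *\<^sub>C x) = (c * d) *\<^sub>C x"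
    and scaleR_eq_scaleC: "scaleR r x = complex_of_real r *\<^sub>C x"
    and cinner_commute: "cinner x y = cnj (cinner y x)"
    and cinner_add_left: "cinner (x + y) z = cinner x z + cinner y z"
    and cinner_scaleC_left: "cinner (c *\<^sub>C x) y = c * cinner x y"
    and inner_eq_Re_cinner: "inner x y = Re (cinner x y)"

lemma vector_space_scaleC: "vector_space (scaleC :: complex \<Rightarrow> 'a::chilbert_space \<Rightarrow> 'a)"
proof
  fix x :: 'a
  show "1 *\<^sub>C x = x"
    using scaleR_eq_scaleC[of 1 x] by simp
qed (simp_all add: scaleC_add_right scaleC_add_left scaleC_scaleC)

instantiation complex :: chilbert_space
begin

definition scaleC_complex_def: "scaleC c (z::complex) = c * z"
definition cinner_complex_def: "cinner (z::complex) w = z * cnj w"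

instance
  by standard
    (auto simp: scaleC_complex_def cinner_complex_def inner_complex_def algebra_simps scaleR_conv_of_real)

end

lemma norm_scaleC: "norm (c *\<^sub>C x) = cmod c * norm (x::'a::chilbert_space)"
proof -
  have "cinner (c *\<^sub>C x) (c *\<^sub>C x) = c * cnj c * cinner x x"
  proof -
    have "cinner x (c *\<^sub>C x) = cnj (c * cinner x x)"
      by (metis cinner_commute cinner_scaleC_left)
    also have "\<dots> = cnj c * cinner x x"
      by (metis complex_cnj_mult cinner_commute)
    finally show ?thesis by (simp add: cinner_scaleC_left)
  qed
  hence "inner (c *\<^sub>C x) (c *\<^sub>C x) = (cmod c)\<^sup>2 * inner x x"
    unfolding inner_eq_Re_cinner
    by (simp flip: complex_norm_square of_real_power)
  thus ?thesis
    by (simp add: norm_eq_sqrt_inner real_sqrt_mult)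
qed

lemma Im_cinner: "Im (cinner x y) = inner ((- \<i>) *\<^sub>C x) (y::'a::chilbert_space)"
  unfolding inner_eq_Re_cinner cinner_scaleC_left by simp


section \<open>The Hilbert space of square-summable sequences in a Hilbert space\<close>

typedef (overloaded) 'a ell2 = "{\<xi> :: nat \<Rightarrow> 'a::chilbert_space. summable (\<lambda>n. (norm (\<xi> n))\<^sup>2)}"
  morphisms coord Abs_ell2
  by (intro exI[of _ "\<lambda>_. 0"]) simp

lemma summable_coord: "summable (\<lambda>n. (norm (coord \<xi> n))\<^sup>2)"
  using coord[of \<xi>] by simp

lemma coord_Abs_ell2: "summable (\<lambda>n. (norm (\<xi> n))\<^sup>2) \<Longrightarrow> coord (Abs_ell2 \<xi>) = \<xi>"
  by (simp add: Abs_ell2_inverse)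

lemma ell2_eqI: "(\<And>n. coord \<xi> n = coord \<eta> n) \<Longrightarrow> \<xi> = \<eta>"
  by (metis coord_inject ext)

lemma norm_add_sq_le: "(norm (x + y))\<^sup>2 \<le> 2 * (norm x)\<^sup>2 + 2 * (norm (y::'a::real_normed_vector))\<^sup>2"
proof -
  have "(norm (x + y))\<^sup>2 \<le> (norm x + norm y)\<^sup>2"
    by (intro power_mono norm_triangle_ineq) simp
  also have "\<dots> \<le> 2 * (norm x)\<^sup>2 + 2 * (norm y)\<^sup>2"
    using sum_squares_bound[of "norm x" "norm y"] by (simp add: power2_sum)
  finally show ?thesis .
qed

lemma summable_sq_add:
  assumes "summable (\<lambda>n. (norm (f n))\<^sup>2)" "summable (\<lambda>n. (norm (g n :: 'a::real_normed_vector))\<^sup>2)"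
  shows "summable (\<lambda>n::nat. (norm (f n + g n))\<^sup>2)"
proof (rule summable_comparison_test')
  show "summable (\<lambda>n. 2 * (norm (f n))\<^sup>2 + 2 * (norm (g n))\<^sup>2)"
    using assms by (intro summable_add summable_mult)
  show "\<And>n. n \<ge> 0 \<Longrightarrow> norm ((norm (f n + g n))\<^sup>2) \<le> 2 * (norm (f n))\<^sup>2 + 2 * (norm (g n))\<^sup>2"
    using norm_add_sq_le by simp
qed

lemma summable_sq_scaleC:
  "summable (\<lambda>n. (norm (f n))\<^sup>2) \<Longrightarrow> summable (\<lambda>n::nat. (norm (c *\<^sub>C (f n :: 'a::chilbert_space)))\<^sup>2)"
  by (simp add: norm_scaleC power_mult_distrib summable_mult)

lemma summable_inner:
  assumes "summable (\<lambda>n. (norm (f n))\<^sup>2)" "summable (\<lambda>n. (norm (g n :: 'a::real_inner))\<^sup>2)"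
  shows "summable (\<lambda>n::nat. inner (f n) (g n))"
proof (rule summable_comparison_test')
  show "summable (\<lambda>n. (norm (f n))\<^sup>2 + (norm (g n))\<^sup>2)"
    using assms by (intro summable_add)
  show "norm (inner (f n) (g n)) \<le> (norm (f n))\<^sup>2 + (norm (g n))\<^sup>2" for n
  proof -
    have "norm (inner (f n) (g n)) \<le> norm (f n) * norm (g n)"
      by (simp add: Cauchy_Schwarz_ineq2)
    also have "\<dots> \<le> 2 * norm (f n) * norm (g n)" by simp
    also have "\<dots> \<le> (norm (f n))\<^sup>2 + (norm (g n))\<^sup>2" by (rule sum_squares_bound)
    finally show ?thesis .
  qed
qed

lemma summable_cinner:
  assumes "summable (\<lambda>n. (norm (f n))\<^sup>2)" "summable (\<lambda>n. (norm (g n :: 'a::chilbert_space))\<^sup>2)"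
  shows "summable (\<lambda>n::nat. cinner (f n) (g n))"
  using summable_inner[OF assms] summable_inner[OF summable_sq_scaleC[OF assms(1)] assms(2), of "-\<i>"]
  unfolding summable_complex_iff Im_cinner inner_eq_Re_cinner[symmetric] by simp

instantiation ell2 :: (chilbert_space) real_inner
begin

definition zero_ell2_def: "0 = Abs_ell2 (\<lambda>n. 0)"
definition plus_ell2_def: "\<xi> + \<eta> = Abs_ell2 (\<lambda>n. coord \<xi> n + coord \<eta> n)"
definition uminus_ell2_def: "- \<xi> = Abs_ell2 (\<lambda>n. - coord \<xi> n)"
definition minus_ell2_def: "\<xi> - \<eta> = Abs_ell2 (\<lambda>n. coord \<xi> n - coord \<eta> n)"
definition scaleR_ell2_def: "r *\<^sub>R \<xi> = Abs_ell2 (\<lambda>n. r *\<^sub>R coord \<xi> n)"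
definition inner_ell2_def: "inner \<xi> \<eta> = suminf (\<lambda>n. inner (coord \<xi> n) (coord \<eta> n))"
definition norm_ell2_def: "norm (\<xi>::'a ell2) = sqrt (inner \<xi> \<xi>)"
definition sgn_ell2_def: "sgn (\<xi>::'a ell2) = inverse (norm \<xi>) *\<^sub>R \<xi>"
definition dist_ell2_def: "dist \<xi> (\<eta>::'a ell2) = norm (\<xi> - \<eta>)"
definition uniformity_ell2_def:
  "(uniformity :: ('a ell2 \<times> 'a ell2) filter) = (INF e\<in>{0<..}. principal {(x, y). dist x y < e})"
definition open_ell2_def:
  "open (U :: 'a ell2 set) \<longleftrightarrow> (\<forall>x\<in>U. eventually (\<lambda>(x', y). x' = x \<longrightarrow> y \<in> U) uniformity)"

lemma coord_zero: "coord 0 n = 0"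
  by (simp add: zero_ell2_def coord_Abs_ell2)

lemma coord_add: "coord (\<xi> + \<eta>) n = coord \<xi> n + coord \<eta> n"
  by (simp add: plus_ell2_def coord_Abs_ell2 summable_sq_add summable_coord)

lemma coord_uminus: "coord (- \<xi>) n = - coord \<xi> n"
  by (simp add: uminus_ell2_def coord_Abs_ell2 summable_coord)

lemma coord_diff: "coord (\<xi> - \<eta>) n = coord \<xi> n - coord \<eta> n"
proof -
  have "summable (\<lambda>n. (norm (coord \<xi> n + - coord \<eta> n))\<^sup>2)"
    by (intro summable_sq_add) (simp_all add: summable_coord)
  thus ?thesis by (simp add: minus_ell2_def coord_Abs_ell2)
qed

lemma coord_scaleR: "coord (r *\<^sub>R \<xi>) n = r *\<^sub>R coord \<xi> n"
  by (simp add: scaleR_ell2_def coord_Abs_ell2 power_mult_distrib summable_mult summable_coord)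

lemma summable_inner_coord: "summable (\<lambda>n. inner (coord \<xi> n) (coord \<eta> n))"
  by (intro summable_inner summable_coord)

instance
proof
  fix x y z :: "'a ell2" and r s :: real
  show "inner x y = inner y x"
    by (simp add: inner_ell2_def inner_commute)
  show "inner (x + y) z = inner x z + inner y z"
    by (simp add: inner_ell2_def coord_add inner_add_left suminf_add summable_inner_coord)
  show "inner (r *\<^sub>R x) y = r * inner x y"
    by (simp add: inner_ell2_def coord_scaleR suminf_mult summable_inner_coord)
  show "0 \<le> inner x x"
    by (simp add: inner_ell2_def suminf_nonneg summable_inner_coord)
  show "inner x x = 0 \<longleftrightarrow> x = 0"
  proof
    assume "inner x x = 0"
    hence "inner (coord x n) (coord x n) = 0" for n
      using suminf_eq_zero_iff[OF summable_inner_coord[of x x]] by (simp add: inner_ell2_def)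
    thus "x = 0" by (intro ell2_eqI) (simp add: coord_zero)
  qed (simp add: inner_ell2_def coord_zero)
qed (auto intro!: ell2_eqI simp: coord_zero coord_add coord_uminus coord_diff coord_scaleR
    norm_ell2_def sgn_ell2_def dist_ell2_def uniformity_ell2_def open_ell2_def algebra_simps)

end

lemma norm_sq_ell2: "(norm \<xi>)\<^sup>2 = suminf (\<lambda>n. (norm (coord \<xi> n))\<^sup>2)"
  by (simp add: power2_norm_eq_inner inner_ell2_def)

lemma sum_coord_le: "(\<Sum>n<k. (norm (coord \<xi> n))\<^sup>2) \<le> (norm \<xi>)\<^sup>2"
  unfolding norm_sq_ell2 by (intro sum_le_suminf summable_coord) auto

lemma norm_coord_le: "norm (coord \<xi> n) \<le> norm \<xi>"
proof -
  have "(norm (coord \<xi> n))\<^sup>2 \<le> (\<Sum>i<Suc n. (norm (coord \<xi> i))\<^sup>2)"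
    by (rule member_le_sum) auto
  also have "\<dots> \<le> (norm \<xi>)\<^sup>2" by (rule sum_coord_le)
  finally show ?thesis by (rule power2_le_imp_le) simp
qed

instance ell2 :: (chilbert_space) complete_space
proof
  fix X :: "nat \<Rightarrow> 'a ell2"
  assume X: "Cauchy X"
  have "Cauchy (\<lambda>m. coord (X m) n)" for n
  proof (rule metric_CauchyI)
    fix e :: real assume "e > 0"
    then obtain M where M: "\<forall>m\<ge>M. \<forall>k\<ge>M. dist (X m) (X k) < e"
      using X by (meson metric_CauchyD)
    have "dist (coord (X m) n) (coord (X k) n) \<le> dist (X m) (X k)" for m k
      using norm_coord_le[of "X m - X k" n] by (simp add: dist_norm coord_diff)
    thus "\<exists>M. \<forall>m\<ge>M. \<forall>k\<ge>M. dist (coord (X m) n) (coord (X k) n) < e"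
      using M by (meson le_less_trans)
  qed
  hence "\<exists>l. (\<lambda>m. coord (X m) n) \<longlonglongrightarrow> l" for n
    by (simp add: Cauchy_convergent_iff convergent_def)
  then obtain l where l: "\<And>n. (\<lambda>m. coord (X m) n) \<longlonglongrightarrow> l n" by metis
  have tail: "\<exists>M. \<forall>m\<ge>M. \<forall>k. (\<Sum>n<k. (norm (coord (X m) n - l n))\<^sup>2) \<le> e\<^sup>2" if "e > 0" for e
  proof -
    obtain M where M: "\<forall>m\<ge>M. \<forall>j\<ge>M. dist (X m) (X j) < e"
      using X \<open>e > 0\<close> by (meson metric_CauchyD)
    have "(\<Sum>n<k. (norm (coord (X m) n - l n))\<^sup>2) \<le> e\<^sup>2" if m: "m \<ge> M" for m k
    proof (rule LIMSEQ_le_const2)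
      show "(\<lambda>j. \<Sum>n<k. (norm (coord (X m) n - coord (X j) n))\<^sup>2)
              \<longlonglongrightarrow> (\<Sum>n<k. (norm (coord (X m) n - l n))\<^sup>2)"
        by (intro tendsto_intros l)
      have "(\<Sum>n<k. (norm (coord (X m) n - coord (X j) n))\<^sup>2) \<le> e\<^sup>2" if "j \<ge> M" for j
      proof -
        have "norm (X m - X j) \<le> e"
          using M m that by (metis dist_norm less_eq_real_def)
        hence "(norm (X m - X j))\<^sup>2 \<le> e\<^sup>2" by (intro power_mono) auto
        thus ?thesis using sum_coord_le[of "X m - X j" k] by (simp add: coord_diff)
      qed
      thus "\<exists>N. \<forall>j\<ge>N. (\<Sum>n<k. (norm (coord (X m) n - coord (X j) n))\<^sup>2) \<le> e\<^sup>2" by blast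
    qed
    thus ?thesis by blast
  qed
  have summ: "summable (\<lambda>n. (norm (coord (X m) n - l n))\<^sup>2)"
    if "\<forall>k. (\<Sum>n<k. (norm (coord (X m) n - l n))\<^sup>2) \<le> e\<^sup>2" for m e
    using that by (intro summableI_nonneg_bounded[of _ "e\<^sup>2"]) auto
  obtain M1 where "\<forall>m\<ge>M1. \<forall>k. (\<Sum>n<k. (norm (coord (X m) n - l n))\<^sup>2) \<le> 1\<^sup>2"
    using tail[of 1] by auto
  hence "summable (\<lambda>n. (norm (coord (X M1) n - l n))\<^sup>2)"
    using summ[of M1 1] by auto
  hence "summable (\<lambda>n. (norm (coord (X M1) n + - (coord (X M1) n - l n)))\<^sup>2)"
    by (intro summable_sq_add summable_coord) (simp add: norm_minus_commute)
  hence l2: "coord (Abs_ell2 l) = l"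
    by (intro coord_Abs_ell2) simp
  have "X \<longlonglongrightarrow> Abs_ell2 l"
  proof (rule metric_LIMSEQ_I)
    fix e :: real assume "e > 0"
    then obtain M where M: "\<forall>m\<ge>M. \<forall>k. (\<Sum>n<k. (norm (coord (X m) n - l n))\<^sup>2) \<le> (e/2)\<^sup>2"
      using tail[of "e/2"] by auto
    have "dist (X m) (Abs_ell2 l) < e" if "m \<ge> M" for m
    proof -
      have b: "\<forall>k. (\<Sum>n<k. (norm (coord (X m) n - l n))\<^sup>2) \<le> (e/2)\<^sup>2" using M that by blast
      have "(norm (X m - Abs_ell2 l))\<^sup>2 \<le> (e/2)\<^sup>2"
        unfolding norm_sq_ell2 coord_diff l2
        by (rule suminf_le_const[OF summ[OF b]]) (use b in blast)
      hence "norm (X m - Abs_ell2 l) \<le> e/2"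
        by (rule power2_le_imp_le) (use \<open>e > 0\<close> in simp)
      thus ?thesis using \<open>e > 0\<close> by (simp add: dist_norm)
    qed
    thus "\<exists>M. \<forall>m\<ge>M. dist (X m) (Abs_ell2 l) < e" by blast
  qed
  thus "convergent X" by (auto simp: convergent_def)
qed

instantiation ell2 :: (chilbert_space) chilbert_space
begin

definition scaleC_ell2_def: "c *\<^sub>C \<xi> = Abs_ell2 (\<lambda>n. c *\<^sub>C coord \<xi> n)"
definition cinner_ell2_def: "cinner \<xi> \<eta> = suminf (\<lambda>n. cinner (coord \<xi> n) (coord \<eta> n))"

lemma coord_scaleC: "coord (c *\<^sub>C \<xi>) n = c *\<^sub>C coord \<xi> n"
  by (simp add: scaleC_ell2_def coord_Abs_ell2 summable_sq_scaleC summable_coord)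

lemma summable_cinner_coord: "summable (\<lambda>n. cinner (coord \<xi> n) (coord \<eta> n))"
  by (intro summable_cinner summable_coord)

instance
proof
  fix x y z :: "'a ell2" and c d :: complex and r :: real
  show "c *\<^sub>C (x + y) = c *\<^sub>C x + c *\<^sub>C y" "(c + d) *\<^sub>C x = c *\<^sub>C x + d *\<^sub>C x"
    "c *\<^sub>C (d *\<^sub>C x) = (c * d) *\<^sub>C x" "r *\<^sub>R x = complex_of_real r *\<^sub>C x"
    by (rule ell2_eqI, simp add: coord_add coord_scaleC coord_scaleR scaleC_add_right scaleC_add_left
        scaleC_scaleC scaleR_eq_scaleC)+
  show "cinner x y = cnj (cinner y x)"
  proof -
    have "(\<lambda>n. cnj (cinner (coord y n) (coord x n))) sums cnj (cinner y x)"
      unfolding cinner_ell2_def sums_cnj by (intro summable_sums summable_cinner_coord)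
    thus ?thesis
      unfolding cinner_ell2_def[of x y] cinner_commute[symmetric] by (rule sums_unique[symmetric])
  qed
  show "cinner (x + y) z = cinner x z + cinner y z"
    by (simp add: cinner_ell2_def coord_add cinner_add_left suminf_add summable_cinner_coord)
  show "cinner (c *\<^sub>C x) y = c * cinner x y"
    by (simp add: cinner_ell2_def coord_scaleC cinner_scaleC_left suminf_mult summable_cinner_coord)
  show "inner x y = Re (cinner x y)"
    by (simp add: cinner_ell2_def inner_ell2_def inner_eq_Re_cinner Re_suminf summable_cinner_coord)
qed

end


section \<open>Concrete C*-algebras\<close>

text \<open>
  The library type \<open>'a \<Rightarrow>\<^sub>L 'a\<close> consists of the bounded real-linear operators, with the operator norm;
  \<open>B(H)\<close> is the subset of complex-linear ones.
\<close>

definition BH :: "('a::chilbert_space \<Rightarrow>\<^sub>L 'a) set" where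
  "BH = {T. \<forall>c x. blinfun_apply T (c *\<^sub>C x) = c *\<^sub>C blinfun_apply T x}"

definition scaleC_op :: "complex \<Rightarrow> ('a::chilbert_space \<Rightarrow>\<^sub>L 'a) \<Rightarrow> ('a \<Rightarrow>\<^sub>L 'a)" where
  "scaleC_op c T = Blinfun (\<lambda>x. c *\<^sub>C T x)"

definition adj :: "('a::chilbert_space \<Rightarrow>\<^sub>L 'a) \<Rightarrow> ('a \<Rightarrow>\<^sub>L 'a)" where
  "adj T = (THE S. \<forall>x y. cinner (blinfun_apply S x) y = cinner x (blinfun_apply T y))"

definition cstar_subalgebra :: "('a::chilbert_space \<Rightarrow>\<^sub>L 'a) set \<Rightarrow> bool" where
  "cstar_subalgebra A \<longleftrightarrow>
     A \<subseteq> BH \<and> closed A \<and> 0 \<in> A \<and>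
     (\<forall>S\<in>A. \<forall>T\<in>A. S + T \<in> A \<and> S o\<^sub>L T \<in> A) \<and>
     (\<forall>c. \<forall>T\<in>A. scaleC_op c T \<in> A) \<and>
     (\<forall>T\<in>A. adj T \<in> A)"

definition Cstar :: "(nat \<Rightarrow> 'a::chilbert_space \<Rightarrow>\<^sub>L 'a) \<Rightarrow> ('a \<Rightarrow>\<^sub>L 'a) set" where
  "Cstar \<gamma> = cstar_subalgebra hull (range \<gamma>)"

definition star_hom ::
  "('a::chilbert_space \<Rightarrow>\<^sub>L 'a) set \<Rightarrow> ('b::chilbert_space \<Rightarrow>\<^sub>L 'b) set
    \<Rightarrow> (('a \<Rightarrow>\<^sub>L 'a) \<Rightarrow> ('b \<Rightarrow>\<^sub>L 'b)) \<Rightarrow> bool" where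
  "star_hom A B \<phi> \<longleftrightarrow>
     \<phi> ` A \<subseteq> B \<and>
     (\<forall>S\<in>A. \<forall>T\<in>A. \<phi> (S + T) = \<phi> S + \<phi> T \<and> \<phi> (S o\<^sub>L T) = \<phi> S o\<^sub>L \<phi> T) \<and>
     (\<forall>c. \<forall>T\<in>A. \<phi> (scaleC_op c T) = scaleC_op c (\<phi> T)) \<and>
     (\<forall>T\<in>A. \<phi> (adj T) = adj (\<phi> T))"

definition cstar_isomorphic ::
  "('a::chilbert_space \<Rightarrow>\<^sub>L 'a) set \<Rightarrow> ('b::chilbert_space \<Rightarrow>\<^sub>L 'b) set \<Rightarrow> bool" where
  "cstar_isomorphic A B \<longleftrightarrow> (\<exists>\<phi>. star_hom A B \<phi> \<and> bij_betw \<phi> A B)"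


section \<open>Noncommutative *-polynomials over \<open>\<rat>(\<i>)\<close>\<close>

datatype letter = Var nat | StarVar nat

text \<open>A polynomial is a finitely supported family of coefficients indexed by words.\<close>

typedef ncpoly =
  "{p :: letter list \<Rightarrow>\<^sub>0 complex. Poly_Mapping.lookup p [] = 0 \<and> (\<forall>w. Re (Poly_Mapping.lookup p w) \<in> \<rat> \<and> Im (Poly_Mapping.lookup p w) \<in> \<rat>)}"
  morphisms coeffs Abs_ncpoly
  by (intro exI[of _ 0]) simp

fun eval_letter :: "(nat \<Rightarrow> 'a::chilbert_space \<Rightarrow>\<^sub>L 'a) \<Rightarrow> letter \<Rightarrow> ('a \<Rightarrow>\<^sub>L 'a)" where
  "eval_letter \<gamma> (Var k) = \<gamma> k"
| "eval_letter \<gamma> (StarVar k) = adj (\<gamma> k)"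

definition eval_word :: "(nat \<Rightarrow> 'a::chilbert_space \<Rightarrow>\<^sub>L 'a) \<Rightarrow> letter list \<Rightarrow> ('a \<Rightarrow>\<^sub>L 'a)" where
  "eval_word \<gamma> w = foldr (\<lambda>l T. eval_letter \<gamma> l o\<^sub>L T) w id_blinfun"

definition eval_poly :: "(nat \<Rightarrow> 'a::chilbert_space \<Rightarrow>\<^sub>L 'a) \<Rightarrow> ncpoly \<Rightarrow> ('a \<Rightarrow>\<^sub>L 'a)" where
  "eval_poly \<gamma> p = (\<Sum>w\<in>Poly_Mapping.keys (coeffs p). scaleC_op (Poly_Mapping.lookup (coeffs p) w) (eval_word \<gamma> w))"


section \<open>Standard Borel parameter spaces\<close>

text \<open>The library \<open>borel\<close> refers to a type class topology; this is the version for explicit topologies.\<close>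

definition borel_of :: "'a topology \<Rightarrow> 'a measure" where
  "borel_of X = sigma (topspace X) {U. openin X U}"

definition unit_ball_BH :: "('a::chilbert_space \<Rightarrow>\<^sub>L 'a) set" where
  "unit_ball_BH = {T \<in> BH. norm T \<le> 1}"

text \<open>The coarsest topology on the unit ball making every matrix coefficient continuous.\<close>

definition wot_unit_ball :: "('a::chilbert_space \<Rightarrow>\<^sub>L 'a) topology" where
  "wot_unit_ball = pullback_topology unit_ball_BH (\<lambda>T (x, y). cinner (blinfun_apply T x) y) euclidean"

text \<open>
  All products below are countable products of second countable spaces (the unit ball because
  \<open>H\<close> is separable), so the product \<open>\<sigma>\<close>-algebras are the Borel sets of the product topologies.
\<close>

definition Gamma_space :: "(nat \<Rightarrow> 'a::chilbert_space \<Rightarrow>\<^sub>L 'a) measure" where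
  "Gamma_space =
     restrict_space (\<Pi>\<^sub>M n\<in>UNIV. borel_of wot_unit_ball) (- {\<lambda>_. 0})"

text \<open>
  A multiplication on \<open>nat\<close> has at most one two-sided identity, so the unit is determined by
  the table; it is not required to be the number zero.
\<close>

definition table_group :: "(nat \<times> nat \<Rightarrow> nat) \<Rightarrow> nat monoid" where
  "table_group f = \<lparr>carrier = UNIV, monoid.mult = (\<lambda>n m. f (n, m)),
     one = (THE e. \<forall>n. f (e, n) = n \<and> f (n, e) = n)\<rparr>"

definition group_tables :: "(nat \<times> nat \<Rightarrow> nat) set" where
  "group_tables = {f. group (table_group f)}"

definition group_table_space :: "(nat \<times> nat \<Rightarrow> nat) measure" where
  "group_table_space = restrict_space (\<Pi>\<^sub>M k\<in>UNIV. count_space UNIV) group_tables"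

definition action_code_space :: "(nat \<times> nat \<Rightarrow> ncpoly \<Rightarrow> ncpoly) measure" where
  "action_code_space = (\<Pi>\<^sub>M k\<in>UNIV. \<Pi>\<^sub>M p\<in>UNIV. count_space UNIV)"


section \<open>Codes for homomorphisms and actions\<close>

definition induces_hom ::
  "(nat \<Rightarrow> 'a::chilbert_space \<Rightarrow>\<^sub>L 'a) \<Rightarrow> (nat \<Rightarrow> 'b::chilbert_space \<Rightarrow>\<^sub>L 'b) \<Rightarrow> (nat \<Rightarrow> ncpoly \<Rightarrow> ncpoly)
    \<Rightarrow> (('a \<Rightarrow>\<^sub>L 'a) \<Rightarrow> ('b \<Rightarrow>\<^sub>L 'b)) \<Rightarrow> bool" where
  "induces_hom \<gamma> \<gamma>' \<Phi> \<phi> \<longleftrightarrow>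
     star_hom (Cstar \<gamma>) (Cstar \<gamma>') \<phi> \<and>
     (\<forall>p. (\<lambda>n. eval_poly \<gamma>' (\<Phi> n p)) \<longlonglongrightarrow> \<phi> (eval_poly \<gamma> p))"

definition hom_code ::
  "(nat \<Rightarrow> 'a::chilbert_space \<Rightarrow>\<^sub>L 'a) \<Rightarrow> (nat \<Rightarrow> 'b::chilbert_space \<Rightarrow>\<^sub>L 'b) \<Rightarrow> (nat \<Rightarrow> ncpoly \<Rightarrow> ncpoly)
    \<Rightarrow> bool" where
  "hom_code \<gamma> \<gamma>' \<Phi> \<longleftrightarrow>
     uniformly_Cauchy_on UNIV (\<lambda>n p. eval_poly \<gamma>' (\<Phi> n p)) \<and> (\<exists>\<phi>. induces_hom \<gamma> \<gamma>' \<Phi> \<phi>)"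

text \<open>
  The homomorphism is unique on \<open>Cstar \<gamma>\<close>, since the elements \<open>eval_poly \<gamma> p\<close> are dense there and
  *-homomorphisms between C*-algebras are continuous; extensionality pins it down outside.
\<close>

definition coded_hom ::
  "(nat \<Rightarrow> 'a::chilbert_space \<Rightarrow>\<^sub>L 'a) \<Rightarrow> (nat \<Rightarrow> 'b::chilbert_space \<Rightarrow>\<^sub>L 'b) \<Rightarrow> (nat \<Rightarrow> ncpoly \<Rightarrow> ncpoly)
    \<Rightarrow> (('a \<Rightarrow>\<^sub>L 'a) \<Rightarrow> ('b \<Rightarrow>\<^sub>L 'b))" where
  "coded_hom \<gamma> \<gamma>' \<Phi> = (THE \<phi>. \<phi> \<in> extensional (Cstar \<gamma>) \<and> induces_hom \<gamma> \<gamma>' \<Phi> \<phi>)"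

definition aut_code :: "(nat \<Rightarrow> 'a::chilbert_space \<Rightarrow>\<^sub>L 'a) \<Rightarrow> (nat \<Rightarrow> ncpoly \<Rightarrow> ncpoly) \<Rightarrow> bool" where
  "aut_code \<gamma> \<Phi> \<longleftrightarrow> hom_code \<gamma> \<gamma> \<Phi> \<and> bij_betw (coded_hom \<gamma> \<gamma> \<Phi>) (Cstar \<gamma>) (Cstar \<gamma>)"

definition coded_action ::
  "(nat \<Rightarrow> 'a::chilbert_space \<Rightarrow>\<^sub>L 'a) \<Rightarrow> (nat \<times> nat \<Rightarrow> ncpoly \<Rightarrow> ncpoly)
    \<Rightarrow> nat \<Rightarrow> ('a \<Rightarrow>\<^sub>L 'a) \<Rightarrow> ('a \<Rightarrow>\<^sub>L 'a)" where
  "coded_action \<gamma> \<Phi> m = coded_hom \<gamma> \<gamma> (\<lambda>n. \<Phi> (m, n))"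

definition action_code ::
  "(nat \<times> nat \<Rightarrow> nat) \<Rightarrow> (nat \<Rightarrow> 'a::chilbert_space \<Rightarrow>\<^sub>L 'a) \<Rightarrow> (nat \<times> nat \<Rightarrow> ncpoly \<Rightarrow> ncpoly) \<Rightarrow> bool" where
  "action_code G \<gamma> \<Phi> \<longleftrightarrow>
     (\<forall>m. aut_code \<gamma> (\<lambda>n. \<Phi> (m, n))) \<and>
     (\<forall>n q. \<Phi> (0, n) q = q) \<and>
     (\<forall>m k n. m \<otimes>\<^bsub>table_group G\<^esub> k = n \<longrightarrow>
        (\<forall>T\<in>Cstar \<gamma>. coded_action \<gamma> \<Phi> m (coded_action \<gamma> \<Phi> k T) = coded_action \<gamma> \<Phi> n T))"

definition Act ::
  "((nat \<times> nat \<Rightarrow> nat) \<times> (nat \<Rightarrow> 'a::chilbert_space \<Rightarrow>\<^sub>L 'a) \<times> (nat \<times> nat \<Rightarrow> ncpoly \<Rightarrow> ncpoly)) set" where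
  "Act = {(G, \<gamma>, \<Phi>). G \<in> group_tables \<and> \<gamma> \<in> space Gamma_space \<and> action_code G \<gamma> \<Phi>}"

definition Act_space ::
  "((nat \<times> nat \<Rightarrow> nat) \<times> (nat \<Rightarrow> 'a::chilbert_space \<Rightarrow>\<^sub>L 'a) \<times> (nat \<times> nat \<Rightarrow> ncpoly \<Rightarrow> ncpoly)) measure" where
  "Act_space = restrict_space (group_table_space \<Otimes>\<^sub>M (Gamma_space \<Otimes>\<^sub>M action_code_space)) Act"


section \<open>The reduced crossed product\<close>

text \<open>
  For an action \<open>\<alpha>\<close> of a group on a concrete C*-algebra \<open>A\<close> of operators on \<open>H\<close>, the reduced crossed
  product is the norm closure of the image of the finitely supported functions from the group to
  \<open>A\<close> under the regular representation on \<open>\<ell>\<^sup>2(G, H)\<close> induced by the inclusion of \<open>A\<close>, given by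
  \<open>(\<pi>(a)\<xi>)(g) = \<alpha>\<^bsub>g\<inverse>\<^esub>(a) \<xi>(g)\<close> and \<open>(\<lambda>\<^bsub>h\<^esub> \<xi>)(g) = \<xi>(h\<inverse>g)\<close>. Up to isomorphism it does not depend
  on the faithful representation of \<open>A\<close>.
\<close>

definition reg_rep ::
  "nat monoid \<Rightarrow> (nat \<Rightarrow> ('a::chilbert_space \<Rightarrow>\<^sub>L 'a) \<Rightarrow> ('a \<Rightarrow>\<^sub>L 'a)) \<Rightarrow> ('a \<Rightarrow>\<^sub>L 'a) \<Rightarrow> ('a ell2 \<Rightarrow>\<^sub>L 'a ell2)" where
  "reg_rep G \<alpha> a = Blinfun (\<lambda>\<xi>. Abs_ell2 (\<lambda>g. \<alpha> (inv\<^bsub>G\<^esub> g) a (coord \<xi> g)))"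

definition left_translation :: "nat monoid \<Rightarrow> nat \<Rightarrow> ('a::chilbert_space ell2 \<Rightarrow>\<^sub>L 'a ell2)" where
  "left_translation G h = Blinfun (\<lambda>\<xi>. Abs_ell2 (\<lambda>g. coord \<xi> (inv\<^bsub>G\<^esub> h \<otimes>\<^bsub>G\<^esub> g)))"

definition reduced_crossed_product ::
  "('a::chilbert_space \<Rightarrow>\<^sub>L 'a) set \<Rightarrow> (nat \<Rightarrow> ('a \<Rightarrow>\<^sub>L 'a) \<Rightarrow> ('a \<Rightarrow>\<^sub>L 'a)) \<Rightarrow> nat monoid
    \<Rightarrow> ('a ell2 \<Rightarrow>\<^sub>L 'a ell2) set" where
  "reduced_crossed_product A \<alpha> G =
     closure {\<Sum>g\<in>F. reg_rep G \<alpha> (a g) o\<^sub>L left_translation G g | F a. finite F \<and> a ` F \<subseteq> A}"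

end

theory Submission
  imports Defs
begin

text \<open>
  The reduced crossed product of \<open>A = C\<^sup>*(\<gamma>)\<close> is generated by the operators
  \<open>\<pi>(\<alpha>\<^sub>h(\<gamma>\<^sub>k)) \<lambda>\<^sub>g\<close> on \<open>\<ell>\<^sup>2(G, H)\<close>, which are countably many contractions. A unitary from
  \<open>\<ell>\<^sup>2(G, H)\<close> onto \<open>H\<close>, chosen once and for all by matching orthonormal bases, carries them to
  operators on \<open>H\<close>, and these form the code of the crossed product. The isomorphism is then
  conjugation by the unitary (\<open>cstar_isomorphic_conj_op\<close>, \<open>Cstar_crossed_generators\<close>).

  The algebra rests on one analytic fact: a homomorphism between C*-algebras of operators is
  contractive (\<open>star_hom_contractive\<close>). It makes the homomorphism described by a code unique, so
  that \<open>coded_hom\<close> denotes it; it bounds the regular representation; and it shows that the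
  elements of \<open>A\<close> all of whose translates yield operators in the generated algebra form a closed set.

  For the Borel property, the Borel structure on the unit ball is generated by the matrix
  coefficients with respect to an orthonormal basis \<open>e\<close> (\<open>measurable_wot_unit_ball\<close>). The basis
  of \<open>\<ell>\<^sup>2(G, H)\<close> consists of the sequences with a single nonzero entry \<open>e\<^sub>b\<close>. On these,
  \<open>\<pi>(\<alpha>\<^sub>h(\<gamma>\<^sub>k)) \<lambda>\<^sub>g\<close> has only one nonzero coordinate, so each coefficient of the code is zero or a
  coefficient of some \<open>\<alpha>\<^sub>m(\<gamma>\<^sub>k)\<close>, with \<open>m\<close> computed in the group. The latter is a limit of
  coefficients of polynomials in \<open>\<gamma>\<close> that are read off from the code of the action, and
  polynomials are Borel functions of \<open>\<gamma>\<close> (\<open>measurable_eval_poly\<close>).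
\<close>

section \<open>Hilbert space preliminaries\<close>

instance chilbert_space \<subseteq> banach ..

lemma cinner_add_right: "cinner x (y + z) = cinner x y + cinner (x::'a::chilbert_space) z"
  by (metis cinner_add_left cinner_commute complex_cnj_add)

lemma cinner_scaleC_right: "cinner x (c *\<^sub>C y) = cnj c * cinner (x::'a::chilbert_space) y"
  by (metis cinner_commute cinner_scaleC_left complex_cnj_mult)

lemma scaleC_one: "1 *\<^sub>C x = (x::'a::chilbert_space)"
  using scaleR_eq_scaleC[of 1 x] by simp

text \<open>A phase factor \<open>c\<close> makes the inner product real, where the real inequality applies.\<close>

lemma cmod_cinner_le: "cmod (cinner x y) \<le> norm x * norm (y::'a::chilbert_space)"
proof -
  define c where "c = cnj (sgn (cinner x y))"
  have "cinner (c *\<^sub>C x) y = of_real (cmod (cinner x y))"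
    by (simp add: c_def cinner_scaleC_left sgn_eq complex_norm_square[symmetric] power2_eq_square)
       (metis complex_norm_square divide_eq_0_iff mult.commute nonzero_eq_divide_eq of_real_eq_0_iff
         of_real_power power2_eq_square)
  hence "cmod (cinner x y) = inner (c *\<^sub>C x) y"
    by (simp add: inner_eq_Re_cinner)
  also have "\<dots> \<le> norm (c *\<^sub>C x) * norm y" by (rule norm_cauchy_schwarz)
  also have "\<dots> \<le> 1 * norm x * norm y"
    unfolding norm_scaleC by (intro mult_right_mono) (auto simp: c_def norm_sgn)
  finally show ?thesis by simp
qed

lemma bounded_bilinear_cinner: "bounded_bilinear (cinner :: 'a::chilbert_space \<Rightarrow> 'a \<Rightarrow> complex)"
proof
  show "\<exists>K. \<forall>a b :: 'a. norm (cinner a b) \<le> norm a * norm b * K"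
    using cmod_cinner_le by (metis mult.right_neutral)
qed (auto simp: cinner_add_left cinner_add_right scaleR_eq_scaleC cinner_scaleC_left
    cinner_scaleC_right scaleC_complex_def scaleR_conv_of_real)

lemmas cinner_zero_left [simp] = bounded_bilinear.zero_left[OF bounded_bilinear_cinner]
lemmas cinner_zero_right [simp] = bounded_bilinear.zero_right[OF bounded_bilinear_cinner]
lemmas cinner_diff_left = bounded_bilinear.diff_left[OF bounded_bilinear_cinner]
lemmas cinner_diff_right = bounded_bilinear.diff_right[OF bounded_bilinear_cinner]
lemmas cinner_sum_left = bounded_bilinear.sum_left[OF bounded_bilinear_cinner]
lemmas tendsto_cinner = bounded_bilinear.tendsto[OF bounded_bilinear_cinner]

lemma cinner_self: "cinner x x = of_real ((norm (x::'a::chilbert_space))\<^sup>2)"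
proof (rule complex_eqI)
  show "Re (cinner x x) = Re (of_real ((norm x)\<^sup>2))"
    by (simp add: power2_norm_eq_inner inner_eq_Re_cinner)
  have "cinner x x = cnj (cinner x x)" by (rule cinner_commute)
  hence "Im (cinner x x) = - Im (cinner x x)" by (metis cnj.sel(2))
  thus "Im (cinner x x) = Im (of_real ((norm x)\<^sup>2))" by simp
qed

lemma cinner_eqI:
  assumes "\<And>y. cinner x y = cinner (x'::'a::chilbert_space) y"
  shows "x = x'"
proof -
  have "cinner (x - x') (x - x') = 0" using assms by (simp add: cinner_diff_left)
  thus ?thesis by (simp add: cinner_self)
qed

lemma scaleC_zero_right [simp]: "c *\<^sub>C (0::'a::chilbert_space) = 0"
  using norm_scaleC[of c "0::'a"] by simp

lemma bounded_linear_scaleC: "bounded_linear (\<lambda>x::'a::chilbert_space. c *\<^sub>C x)"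
proof
  show "\<exists>K. \<forall>x::'a. norm (c *\<^sub>C x) \<le> norm x * K"
    by (intro exI[of _ "cmod c"]) (simp add: norm_scaleC mult.commute)
qed (auto simp: scaleC_add_right scaleR_eq_scaleC scaleC_scaleC mult.commute)

text \<open>
  The representing vector minimises \<open>J x = \<parallel>x\<parallel>\<^sup>2 / 2 - f x\<close>: by the parallelogram law every
  minimising sequence is Cauchy, and at a minimum the derivative \<open>inner v h - f h\<close> of \<open>J\<close> in
  each direction \<open>h\<close> vanishes.
\<close>

lemma riesz_representation:
  fixes f :: "'a::{real_inner,complete_space} \<Rightarrow> real"
  assumes "bounded_linear f"
  shows "\<exists>v. \<forall>y. f y = inner v y"
proof -
  interpret f: bounded_linear f by fact
  define J where "J x = (norm x)\<^sup>2 / 2 - f x" for x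
  obtain K where K: "\<And>x. norm (f x) \<le> norm x * K" using f.bounded by blast
  have J_lower: "- (K\<^sup>2 / 2) \<le> J x" for x
  proof -
    have "f x \<le> norm x * K" using K[of x] by simp
    moreover have "2 * (norm x * K) \<le> (norm x)\<^sup>2 + K\<^sup>2"
      using sum_squares_bound[of "norm x" K] by simp
    ultimately show ?thesis by (simp add: J_def)
  qed
  define m where "m = (INF x. J x)"
  have bdd: "bdd_below (range J)" using J_lower by (auto simp: bdd_below_def)
  have m_le: "m \<le> J x" for x unfolding m_def by (rule cINF_lower[OF bdd]) simp
  have "\<exists>x. J x < m + inverse (real (Suc n))" for n
  proof -
    have "(INF x. J x) < m + inverse (real (Suc n))" by (simp add: m_def)
    thus ?thesis using cINF_less_iff[OF _ bdd] by auto
  qed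
  then obtain X where X: "\<And>n. J (X n) < m + inverse (real (Suc n))" by metis
  have parallelogram: "(norm (x - y))\<^sup>2 \<le> 4 * (J x - m) + 4 * (J y - m)" for x y
  proof -
    have "m \<le> J ((1/2) *\<^sub>R (x + y))" by (rule m_le)
    also have "\<dots> = (norm (x + y))\<^sup>2 / 8 - (f x + f y) / 2"
      by (simp add: J_def f.scaleR f.add power_mult_distrib power2_eq_square)
    finally have "8 * m \<le> (norm (x + y))\<^sup>2 - 4 * (f x + f y)" by linarith
    moreover have "(norm (x + y))\<^sup>2 + (norm (x - y))\<^sup>2 = 2 * (norm x)\<^sup>2 + 2 * (norm y)\<^sup>2"
      by (simp add: power2_norm_eq_inner inner_add inner_diff inner_commute)
    ultimately show ?thesis by (simp add: J_def)
  qed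
  have "Cauchy X"
  proof (rule metric_CauchyI)
    fix e :: real assume e: "e > 0"
    then obtain N where N: "inverse (real (Suc N)) < e\<^sup>2 / 8"
      using reals_Archimedean[of "e\<^sup>2 / 8"] by auto
    have "dist (X i) (X j) < e" if "i \<ge> N" "j \<ge> N" for i j
    proof -
      have *: "J (X k) - m < e\<^sup>2 / 8" if "k \<ge> N" for k
      proof -
        have "inverse (real (Suc k)) \<le> inverse (real (Suc N))" using that by (simp add: le_imp_inverse_le)
        thus ?thesis using X[of k] N by linarith
      qed
      have "(norm (X i - X j))\<^sup>2 < e\<^sup>2"
        using parallelogram[of "X i" "X j"] *[OF that(1)] *[OF that(2)] by argo
      thus ?thesis using e by (simp add: dist_norm power_less_imp_less_base)
    qed
    thus "\<exists>N. \<forall>i\<ge>N. \<forall>j\<ge>N. dist (X i) (X j) < e" by blast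
  qed
  then obtain v where v: "X \<longlonglongrightarrow> v" using Cauchy_convergent_iff convergent_def by blast
  have "(\<lambda>n. J (X n)) \<longlonglongrightarrow> J v"
    unfolding J_def by (intro tendsto_intros v f.tendsto) simp
  moreover have "(\<lambda>n. m + inverse (real (Suc n))) \<longlonglongrightarrow> m + 0"
    by (intro tendsto_intros LIMSEQ_inverse_real_of_nat)
  ultimately have "J v \<le> m + 0"
    by (rule LIMSEQ_le) (use X less_imp_le in blast)
  hence v_min: "J v \<le> J x" for x using m_le[of x] by simp
  have "f h = inner v h" for h
  proof -
    define D where "D = inner v h - f h"
    define s where "s = D / (1 + (norm h)\<^sup>2)"
    have pos: "1 + (norm h)\<^sup>2 > 0" by (smt (verit) zero_le_power2)
    have "0 \<le> J (v + (- s) *\<^sub>R h) - J v" using v_min by simp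
    also have "\<dots> = - s * D + s\<^sup>2 * (norm h)\<^sup>2 / 2"
      by (simp only: J_def f.add f.scaleR power2_norm_eq_inner inner_add inner_scaleR_left
            inner_scaleR_right D_def inner_commute[of h v])
         (simp add: field_simps power2_eq_square)
    also have "\<dots> \<le> - s * D + s\<^sup>2 * (1 + (norm h)\<^sup>2) / 2"
      by (simp add: mult_left_mono)
    also have "s\<^sup>2 * (1 + (norm h)\<^sup>2) = s * D"
      using pos by (simp add: s_def power2_eq_square)
    finally have "s * D \<le> 0" by (simp add: mult.commute)
    moreover have "D\<^sup>2 = s * D * (1 + (norm h)\<^sup>2)"
      using pos by (simp add: s_def power2_eq_square)
    ultimately have "D\<^sup>2 \<le> 0" using pos by (simp add: mult_nonpos_nonneg)
    thus ?thesis by (simp add: D_def)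
  qed
  thus ?thesis by blast
qed

section \<open>Bounded operators and their adjoints\<close>

lemma BH_apply: "T \<in> BH \<Longrightarrow> blinfun_apply T (c *\<^sub>C x) = c *\<^sub>C blinfun_apply T x"
  by (simp add: BH_def)

lemma scaleC_op_apply: "blinfun_apply (scaleC_op c T) x = c *\<^sub>C blinfun_apply T x"
proof -
  have "bounded_linear (\<lambda>x. c *\<^sub>C blinfun_apply T x)"
    by (rule bounded_linear_compose[OF bounded_linear_scaleC blinfun.bounded_linear_right])
  thus ?thesis by (simp add: scaleC_op_def bounded_linear_Blinfun_apply)
qed

lemma norm_scaleC_op_le: "norm (scaleC_op c T) \<le> cmod c * norm T"
  by (rule norm_blinfun_bound)
     (auto simp: scaleC_op_apply norm_scaleC mult.assoc intro!: mult_left_mono norm_blinfun)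

lemma bounded_linear_scaleC_op: "bounded_linear (scaleC_op c :: ('a::chilbert_space \<Rightarrow>\<^sub>L 'a) \<Rightarrow> _)"
proof
  show "\<exists>K. \<forall>T::'a \<Rightarrow>\<^sub>L 'a. norm (scaleC_op c T) \<le> norm T * K"
    using norm_scaleC_op_le by (metis mult.commute)
qed (auto intro!: blinfun_eqI simp: scaleC_op_apply plus_blinfun.rep_eq scaleR_blinfun.rep_eq
    scaleC_add_right scaleR_eq_scaleC scaleC_scaleC mult.commute)

lemma scaleR_eq_scaleC_op: "r *\<^sub>R T = scaleC_op (of_real r) T"
  by (rule blinfun_eqI) (simp add: scaleC_op_apply scaleR_blinfun.rep_eq scaleR_eq_scaleC)

lemma adjoint_exists:
  fixes T :: "'a::chilbert_space \<Rightarrow>\<^sub>L 'a"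
  assumes T: "T \<in> BH"
  shows "\<exists>S. \<forall>x y. cinner (blinfun_apply S x) y = cinner x (blinfun_apply T y)"
proof -
  have "\<exists>v. \<forall>y. inner x (blinfun_apply T y) = inner v y" for x
    by (intro riesz_representation bounded_linear_compose[OF bounded_linear_inner_right
          blinfun.bounded_linear_right])
  then obtain S where S: "\<And>x y. inner x (blinfun_apply T y) = inner (S x) y" by metis
  \<comment> \<open>The imaginary parts agree because \<open>T\<close> commutes with multiplication by \<open>\<i>\<close>.\<close>
  have Im_eq: "Im (cinner x y) = inner x (\<i> *\<^sub>C y)" for x y :: 'a
    by (simp add: inner_eq_Re_cinner cinner_scaleC_right)
  have *: "cinner (S x) y = cinner x (blinfun_apply T y)" for x y
    using S[of x y] S[of x "\<i> *\<^sub>C y"]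
    by (intro complex_eqI) (simp_all add: inner_eq_Re_cinner[symmetric] Im_eq BH_apply[OF T])
  have "bounded_linear S"
  proof
    show "S (x + y) = S x + S y" for x y
      by (rule cinner_eqI) (simp add: * cinner_add_left)
    show "S (r *\<^sub>R x) = r *\<^sub>R S x" for r x
      by (rule cinner_eqI) (simp add: * scaleR_eq_scaleC cinner_scaleC_left)
    have "norm (S x) \<le> norm x * norm T" for x
    proof -
      have "norm (S x) * norm (S x) = inner x (blinfun_apply T (S x))"
        by (simp add: S power2_norm_eq_inner[symmetric] power2_eq_square)
      also have "\<dots> \<le> norm x * norm (blinfun_apply T (S x))" by (rule norm_cauchy_schwarz)
      also have "\<dots> \<le> norm x * (norm T * norm (S x))"
        by (intro mult_left_mono norm_blinfun) simp
      finally have "norm (S x) * norm (S x) \<le> (norm x * norm T) * norm (S x)" by (simp add: mult.assoc)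
      thus ?thesis by (cases "S x = 0") auto
    qed
    thus "\<exists>K. \<forall>x. norm (S x) \<le> norm x * K" by blast
  qed
  thus ?thesis
    using * by (intro exI[of _ "Blinfun S"]) (simp add: bounded_linear_Blinfun_apply)
qed

lemma adj_eqI:
  assumes "\<And>x y. cinner (blinfun_apply S x) y = cinner x (blinfun_apply T y)"
  shows "adj T = S"
  unfolding adj_def
proof (rule the_equality)
  fix S' assume "\<forall>x y. cinner (blinfun_apply S' x) y = cinner x (blinfun_apply T y)"
  thus "S' = S" by - (rule blinfun_eqI, rule cinner_eqI, simp add: assms)
qed (use assms in blast)

lemma cinner_adj_left:
  assumes "T \<in> BH"
  shows "cinner (blinfun_apply (adj T) x) y = cinner x (blinfun_apply T y)"
  using adjoint_exists[OF assms] adj_eqI[of _ T] by metis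

lemma cinner_adj_right:
  assumes "T \<in> BH"
  shows "cinner x (blinfun_apply (adj T) y) = cinner (blinfun_apply T x) y"
  using cinner_adj_left[OF assms] by (metis cinner_commute)

lemma adj_in_BH:
  assumes "T \<in> BH"
  shows "adj T \<in> BH"
  unfolding BH_def
  by (intro CollectI allI, rule cinner_eqI) (simp add: cinner_adj_left[OF assms] cinner_scaleC_left)

lemma adj_adj: "T \<in> BH \<Longrightarrow> adj (adj T) = T"
  by (rule adj_eqI) (simp add: cinner_adj_right)

lemma norm_adj_le:
  fixes T :: "'a::chilbert_space \<Rightarrow>\<^sub>L 'a"
  assumes "T \<in> BH"
  shows "norm (adj T) \<le> norm T"
proof (rule norm_blinfun_bound)
  fix x
  let ?y = "blinfun_apply (adj T) x"
  have "norm ?y * norm ?y = inner x (blinfun_apply T ?y)"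
    unfolding inner_eq_Re_cinner cinner_adj_left[OF assms, symmetric]
    by (simp add: cinner_self power2_eq_square)
  also have "\<dots> \<le> norm x * norm (blinfun_apply T ?y)" by (rule norm_cauchy_schwarz)
  also have "\<dots> \<le> norm x * (norm T * norm ?y)" by (intro mult_left_mono norm_blinfun) simp
  finally have "norm ?y * norm ?y \<le> (norm T * norm x) * norm ?y" by (simp add: mult_ac)
  thus "norm ?y \<le> norm T * norm x" by (cases "?y = 0") auto
qed simp

lemma adj_add: "S \<in> BH \<Longrightarrow> T \<in> BH \<Longrightarrow> adj (S + T) = adj S + adj T"
  by (rule adj_eqI) (simp add: plus_blinfun.rep_eq cinner_add_left cinner_add_right cinner_adj_left)

lemma adj_diff: "S \<in> BH \<Longrightarrow> T \<in> BH \<Longrightarrow> adj (S - T) = adj S - adj T"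
  by (rule adj_eqI) (simp add: minus_blinfun.rep_eq cinner_diff_left cinner_diff_right cinner_adj_left)

lemma adj_compose: "S \<in> BH \<Longrightarrow> T \<in> BH \<Longrightarrow> adj (S o\<^sub>L T) = adj T o\<^sub>L adj S"
  by (rule adj_eqI) (simp add: cinner_adj_left)

lemma adj_scaleC_op: "T \<in> BH \<Longrightarrow> adj (scaleC_op c T) = scaleC_op (cnj c) (adj T)"
  by (rule adj_eqI) (simp add: scaleC_op_apply cinner_scaleC_left cinner_scaleC_right cinner_adj_left)

lemma adj_zero [simp]: "adj 0 = 0"
  by (rule adj_eqI) simp

lemma zero_in_BH [simp]: "0 \<in> BH" by (simp add: BH_def)

lemma add_in_BH: "S \<in> BH \<Longrightarrow> T \<in> BH \<Longrightarrow> S + T \<in> BH"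
  by (simp add: BH_def plus_blinfun.rep_eq scaleC_add_right)

lemma compose_in_BH: "S \<in> BH \<Longrightarrow> T \<in> BH \<Longrightarrow> S o\<^sub>L T \<in> BH"
  by (simp add: BH_def)

lemma scaleC_op_in_BH: "T \<in> BH \<Longrightarrow> scaleC_op c T \<in> BH"
  by (simp add: BH_def scaleC_op_apply scaleC_scaleC mult.commute)

lemma closed_BH: "closed (BH :: ('a::chilbert_space \<Rightarrow>\<^sub>L 'a) set)"
  unfolding closed_sequential_limits
proof (intro allI impI, elim conjE)
  fix X and T :: "'a \<Rightarrow>\<^sub>L 'a"
  assume X: "\<forall>n. X n \<in> BH" and lim: "X \<longlonglongrightarrow> T"
  have pt: "(\<lambda>n. blinfun_apply (X n) x) \<longlonglongrightarrow> blinfun_apply T x" for x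
    by (intro tendsto_intros lim)
  show "T \<in> BH"
    unfolding BH_def
  proof (intro CollectI allI)
    fix c x
    have "(\<lambda>n. blinfun_apply (X n) (c *\<^sub>C x)) \<longlonglongrightarrow> c *\<^sub>C blinfun_apply T x"
      using bounded_linear.tendsto[OF bounded_linear_scaleC pt] X by (simp add: BH_apply)
    thus "blinfun_apply T (c *\<^sub>C x) = c *\<^sub>C blinfun_apply T x"
      using pt LIMSEQ_unique by blast
  qed
qed

lemma tendsto_adj:
  assumes "\<And>n. X n \<in> BH" "X \<longlonglongrightarrow> T"
  shows "(\<lambda>n. adj (X n)) \<longlonglongrightarrow> adj T"
proof -
  have T: "T \<in> BH" using closed_BH assms closed_sequentially by blast
  have "(\<lambda>n. X n - T) \<longlonglongrightarrow> 0" using assms(2) by (simp add: LIM_zero)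
  hence 0: "(\<lambda>n. norm (X n - T)) \<longlonglongrightarrow> 0" by (rule tendsto_norm_zero)
  have "(\<lambda>n. adj (X n) - adj T) \<longlonglongrightarrow> 0"
  proof (rule Lim_null_comparison[OF _ 0], rule always_eventually, rule allI)
    fix n
    have "X n - T \<in> BH" using assms(1) T
      by (simp add: BH_def minus_blinfun.rep_eq bounded_linear.linear[OF bounded_linear_scaleC] linear_diff)
    thus "norm (adj (X n) - adj T) \<le> norm (X n - T)"
      using norm_adj_le assms(1) T by (metis adj_diff)
  qed
  thus ?thesis by (simp add: LIM_zero_iff)
qed

lemma cstar_subalgebra_BH: "cstar_subalgebra BH"
  by (auto simp: cstar_subalgebra_def closed_BH add_in_BH compose_in_BH scaleC_op_in_BH adj_in_BH)

lemma lim_in_closure: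
  fixes T :: "'a::first_countable_topology"
  shows "(\<And>n. X n \<in> R) \<Longrightarrow> X \<longlonglongrightarrow> T \<Longrightarrow> T \<in> closure R"
  unfolding closure_sequential by blast

lemma cstar_subalgebra_closure:
  assumes "R \<subseteq> BH" "0 \<in> R"
    and "\<And>S T. S \<in> R \<Longrightarrow> T \<in> R \<Longrightarrow> S + T \<in> R"
    and "\<And>S T. S \<in> R \<Longrightarrow> T \<in> R \<Longrightarrow> S o\<^sub>L T \<in> R"
    and "\<And>c T. T \<in> R \<Longrightarrow> scaleC_op c T \<in> R"
    and "\<And>T. T \<in> R \<Longrightarrow> adj T \<in> R"
  shows "cstar_subalgebra (closure R)"
proof -
  have sub: "closure R \<subseteq> BH" by (rule closure_minimal[OF assms(1) closed_BH])
  have add: "S + T \<in> closure R" "S o\<^sub>L T \<in> closure R"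
    if S: "S \<in> closure R" and T: "T \<in> closure R" for S T
  proof -
    obtain X Y where "\<And>n. X n \<in> R" "X \<longlonglongrightarrow> S" "\<And>n. Y n \<in> R" "Y \<longlonglongrightarrow> T"
      using S T unfolding closure_sequential by blast
    hence "\<And>n. X n + Y n \<in> R" "(\<lambda>n. X n + Y n) \<longlonglongrightarrow> S + T"
      "\<And>n. X n o\<^sub>L Y n \<in> R" "(\<lambda>n. X n o\<^sub>L Y n) \<longlonglongrightarrow> (S o\<^sub>L T)"
      using assms(3,4) by (auto intro!: tendsto_add bounded_bilinear.tendsto[OF bounded_bilinear_blinfun_compose])
    thus "S + T \<in> closure R" "S o\<^sub>L T \<in> closure R"
      using lim_in_closure[of "\<lambda>n. X n + Y n"] lim_in_closure[of "\<lambda>n. X n o\<^sub>L Y n"] by simp_all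
  qed
  have sc: "scaleC_op c T \<in> closure R" "adj T \<in> closure R" if T: "T \<in> closure R" for c T
  proof -
    obtain X where X: "\<And>n. X n \<in> R" "X \<longlonglongrightarrow> T" using T unfolding closure_sequential by blast
    hence "(\<lambda>n. scaleC_op c (X n)) \<longlonglongrightarrow> scaleC_op c T" "(\<lambda>n. adj (X n)) \<longlonglongrightarrow> adj T"
      using assms(1) by (auto intro!: bounded_linear.tendsto[OF bounded_linear_scaleC_op] tendsto_adj)
    thus "scaleC_op c T \<in> closure R" "adj T \<in> closure R"
      using X(1) assms(5,6) lim_in_closure[of "\<lambda>n. scaleC_op c (X n)"]
        lim_in_closure[of "\<lambda>n. adj (X n)"] by simp_all
  qed
  show ?thesis
    unfolding cstar_subalgebra_def using sub add sc subsetD[OF closure_subset assms(2)] by simp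
qed

context
  fixes A :: "('a::chilbert_space \<Rightarrow>\<^sub>L 'a) set"
  assumes A: "cstar_subalgebra A"
begin

lemma cstar_subset_BH: "A \<subseteq> BH"
  and cstar_closed: "closed A"
  and cstar_zero: "0 \<in> A"
  and cstar_add: "S \<in> A \<Longrightarrow> T \<in> A \<Longrightarrow> S + T \<in> A"
  and cstar_compose: "S \<in> A \<Longrightarrow> T \<in> A \<Longrightarrow> S o\<^sub>L T \<in> A"
  and cstar_scaleC: "T \<in> A \<Longrightarrow> scaleC_op c T \<in> A"
  and cstar_adj: "T \<in> A \<Longrightarrow> adj T \<in> A"
  using A by (auto simp: cstar_subalgebra_def)

lemma cstar_in_BH: "T \<in> A \<Longrightarrow> T \<in> BH"
  using cstar_subset_BH by blast

lemma cstar_scaleR: "T \<in> A \<Longrightarrow> r *\<^sub>R T \<in> A"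
  by (simp add: scaleR_eq_scaleC_op cstar_scaleC)

end

lemma cstar_subalgebra_Cstar:
  assumes "range \<gamma> \<subseteq> BH"
  shows "cstar_subalgebra (Cstar \<gamma>)"
proof -
  have "cstar_subalgebra (\<Inter>F)" if "\<And>B. B \<in> F \<Longrightarrow> cstar_subalgebra B" "F \<noteq> {}" for F :: "('a \<Rightarrow>\<^sub>L 'a) set set"
    using that unfolding cstar_subalgebra_def by (blast intro: closed_Inter)
  from this[of "{B. cstar_subalgebra B \<and> range \<gamma> \<subseteq> B}"] show ?thesis
    unfolding Cstar_def hull_def using cstar_subalgebra_BH assms by blast
qed

lemma generator_in_Cstar: "\<gamma> k \<in> Cstar \<gamma>"
  unfolding Cstar_def by (rule subsetD[OF hull_subset]) simp

lemma Cstar_minimal: "cstar_subalgebra B \<Longrightarrow> range \<gamma> \<subseteq> B \<Longrightarrow> Cstar \<gamma> \<subseteq> B"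
  unfolding Cstar_def by (rule hull_minimal)

section \<open>Homomorphisms between concrete C*-algebras\<close>

context
  fixes A :: "('a::chilbert_space \<Rightarrow>\<^sub>L 'a) set" and B :: "('b::chilbert_space \<Rightarrow>\<^sub>L 'b) set" and \<phi>
  assumes hom: "star_hom A B \<phi>"
begin

lemma star_hom_maps: "T \<in> A \<Longrightarrow> \<phi> T \<in> B"
  and star_hom_add: "S \<in> A \<Longrightarrow> T \<in> A \<Longrightarrow> \<phi> (S + T) = \<phi> S + \<phi> T"
  and star_hom_compose: "S \<in> A \<Longrightarrow> T \<in> A \<Longrightarrow> \<phi> (S o\<^sub>L T) = \<phi> S o\<^sub>L \<phi> T"
  and star_hom_scaleC: "T \<in> A \<Longrightarrow> \<phi> (scaleC_op c T) = scaleC_op c (\<phi> T)"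
  and star_hom_adj: "T \<in> A \<Longrightarrow> \<phi> (adj T) = adj (\<phi> T)"
  using hom by (auto simp: star_hom_def)

lemma star_hom_scaleR: "T \<in> A \<Longrightarrow> \<phi> (r *\<^sub>R T) = r *\<^sub>R \<phi> T"
  by (simp add: scaleR_eq_scaleC_op star_hom_scaleC)

end

text \<open>
  Solving \<open>d = (c + d\<^sup>2) / 2\<close> amounts to writing \<open>1 - c = (1 - d)\<^sup>2\<close>, so \<open>1 - d\<close> is a square root of
  the positive operator \<open>1 - c\<close>, described without a unit in the algebra. The map on the
  right-hand side is a contraction of the ball of radius \<open>\<parallel>c\<parallel> < 1\<close>; uniqueness of its fixed
  point makes \<open>d\<close> self-adjoint.
\<close>

lemma selfadjoint_square_root:
  assumes A: "cstar_subalgebra A" and c: "c \<in> A" "adj c = c" "norm c < 1"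
  shows "\<exists>d\<in>A. adj d = d \<and> c + (d o\<^sub>L d) = d + d"
proof -
  define r where "r = norm c"
  define S where "S = A \<inter> cball 0 r"
  define f where "f d = (1/2) *\<^sub>R (c + (d o\<^sub>L d))" for d
  have r: "0 \<le> r" "r < 1" using c by (auto simp: r_def)
  have sq: "norm (d o\<^sub>L d) \<le> r" if "norm d \<le> r" for d :: "'a \<Rightarrow>\<^sub>L 'a"
  proof -
    have "norm (d o\<^sub>L d) \<le> norm d * norm d" by (rule norm_blinfun_compose)
    also have "\<dots> \<le> r * 1" using that r by (intro mult_mono) auto
    finally show ?thesis by simp
  qed
  have fS: "f d \<in> S" if "d \<in> S" for d
  proof -
    have "norm (c + (d o\<^sub>L d)) \<le> r + r"
      using sq[of d] that by (intro order_trans[OF norm_triangle_ineq] add_mono) (auto simp: r_def S_def)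
    thus ?thesis
      using that c by (auto simp: f_def S_def intro!: cstar_scaleR[OF A] cstar_add[OF A] cstar_compose[OF A])
  qed
  have lip: "dist (f d) (f e) \<le> r * dist d e" if "d \<in> S" "e \<in> S" for d e
  proof -
    have "(d o\<^sub>L d) - (e o\<^sub>L e) = (d o\<^sub>L (d - e)) + ((d - e) o\<^sub>L e)"
      by (rule blinfun_eqI) (simp add: minus_blinfun.rep_eq plus_blinfun.rep_eq blinfun.diff_right)
    hence "norm ((d o\<^sub>L d) - (e o\<^sub>L e)) \<le> norm d * norm (d - e) + norm (d - e) * norm e"
      by (simp only:) (intro order_trans[OF norm_triangle_ineq] add_mono norm_blinfun_compose)
    also have "\<dots> \<le> r * norm (d - e) + norm (d - e) * r"
      using that by (intro add_mono mult_right_mono mult_left_mono) (auto simp: S_def)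
    finally have "norm ((d o\<^sub>L d) - (e o\<^sub>L e)) \<le> 2 * (r * norm (d - e))" by simp
    moreover have "dist (f d) (f e) = norm ((d o\<^sub>L d) - (e o\<^sub>L e)) / 2"
      by (simp add: f_def dist_norm flip: scaleR_diff_right)
    ultimately show ?thesis by (simp add: dist_norm)
  qed
  have "complete S"
    unfolding S_def complete_eq_closed by (intro closed_Int cstar_closed[OF A] closed_cball)
  hence "\<exists>!d\<in>S. f d = d"
    by (rule Banach_fix) (use r fS lip cstar_zero[OF A] in \<open>auto simp: S_def\<close>)
  then obtain d where d: "d \<in> S" "f d = d" and uniq: "\<And>e. e \<in> S \<Longrightarrow> f e = e \<Longrightarrow> e = d" by blast
  have dBH: "d \<in> BH" and cBH: "c \<in> BH" using d(1) c cstar_in_BH[OF A] by (auto simp: S_def)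
  have eq: "c + (d o\<^sub>L d) = 2 *\<^sub>R d"
    using arg_cong[OF d(2), of "\<lambda>x. 2 *\<^sub>R x"] by (simp add: f_def)
  have "adj d = d"
  proof (rule uniq)
    show "adj d \<in> S"
      using d(1) order_trans[OF norm_adj_le[OF dBH]] cstar_adj[OF A] by (auto simp: S_def)
    have "c + (adj d o\<^sub>L adj d) = adj (c + (d o\<^sub>L d))"
      by (simp add: adj_add adj_compose compose_in_BH cBH dBH c)
    also have "\<dots> = 2 *\<^sub>R adj d"
      unfolding eq by (simp add: scaleR_eq_scaleC_op adj_scaleC_op dBH)
    finally show "f (adj d) = adj d" by (simp add: f_def)
  qed
  thus ?thesis using d(1) eq by (auto simp: S_def scaleR_2)
qed

text \<open>
  If \<open>\<parallel>T\<parallel> < 1\<close>, the square root \<open>1 - d\<close> of \<open>1 - T\<^sup>* T\<close> is carried to a self-adjoint square root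
  of \<open>1 - \<phi>(T)\<^sup>* \<phi>(T)\<close>, which is therefore positive.
\<close>

lemma star_hom_contractive:
  fixes A :: "('a::chilbert_space \<Rightarrow>\<^sub>L 'a) set" and B :: "('b::chilbert_space \<Rightarrow>\<^sub>L 'b) set"
  assumes A: "cstar_subalgebra A" and B: "cstar_subalgebra B" and hom: "star_hom A B \<phi>"
    and T: "T \<in> A"
  shows "norm (\<phi> T) \<le> norm T"
proof -
  have unit_ball: "norm (\<phi> T) \<le> 1" if T: "T \<in> A" "norm T < 1" for T
  proof -
    define c where "c = adj T o\<^sub>L T"
    have TBH: "T \<in> BH" using T A cstar_in_BH by blast
    have "norm c \<le> norm T * norm T"
      unfolding c_def using norm_adj_le[OF TBH]
      by (intro order_trans[OF norm_blinfun_compose] mult_right_mono) auto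
    also have "\<dots> \<le> norm T * 1" using T by (intro mult_left_mono) auto
    finally have c: "norm c < 1" "c \<in> A" "adj c = c"
      using T TBH A by (auto simp: c_def cstar_compose cstar_adj adj_compose adj_in_BH adj_adj)
    obtain d where d: "d \<in> A" "adj d = d" "c + (d o\<^sub>L d) = d + d"
      using selfadjoint_square_root[OF A c(2,3,1)] by blast
    define D where "D = \<phi> d"
    have "adj D = D" using star_hom_adj[OF hom d(1)] d(2) by (simp add: D_def)
    have D: "D \<in> BH" and \<phi>T: "\<phi> T \<in> BH"
      using star_hom_maps[OF hom] d(1) T cstar_in_BH[OF B] by (auto simp: D_def)
    have "\<phi> c + (D o\<^sub>L D) = \<phi> (c + (d o\<^sub>L d))"
      by (simp add: star_hom_add[OF hom] star_hom_compose[OF hom] cstar_compose[OF A] c(2) d(1) D_def)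
    hence "\<phi> c + (D o\<^sub>L D) = D + D"
      by (simp add: d(1,3) star_hom_add[OF hom] D_def)
    hence eq: "blinfun_apply (\<phi> c) x + D (D x) = D x + D x" for x
      by (metis blinfun_apply_blinfun_compose plus_blinfun.rep_eq)
    have \<phi>c: "\<phi> c = adj (\<phi> T) o\<^sub>L \<phi> T"
      using star_hom_compose[OF hom] star_hom_adj[OF hom] T A by (simp add: c_def cstar_adj)
    show ?thesis
    proof (rule norm_blinfun_bound)
      fix x
      have Dsym: "cinner (D y) z = cinner y (D z)" for y z
        using cinner_adj_left[OF D, of y z] \<open>adj D = D\<close> by simp
      have "blinfun_apply (\<phi> c) x = D x + D x - D (D x)" using eq[of x] by (simp add: algebra_simps)
      hence "cinner (blinfun_apply (\<phi> c) x) x = cinner x x - cinner (x - D x) (x - D x)"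
        by (simp add: cinner_diff_left cinner_diff_right cinner_add_left Dsym)
      moreover have "cinner (blinfun_apply (\<phi> c) x) x = cinner (\<phi> T x) (\<phi> T x)"
        by (simp add: \<phi>c cinner_adj_left[OF \<phi>T])
      ultimately have "complex_of_real ((norm (\<phi> T x))\<^sup>2) = of_real ((norm x)\<^sup>2 - (norm (x - D x))\<^sup>2)"
        by (simp only: cinner_self of_real_diff)
      hence "(norm (\<phi> T x))\<^sup>2 = (norm x)\<^sup>2 - (norm (x - D x))\<^sup>2"
        by (simp only: of_real_eq_iff)
      hence "(norm (\<phi> T x))\<^sup>2 \<le> (norm x)\<^sup>2" by simp
      thus "norm (\<phi> T x) \<le> 1 * norm x" by (simp add: power2_le_iff_abs_le)
    qed simp
  qed
  \<comment> \<open>The square root is available only below norm \<open>1\<close>, so \<open>T\<close> is rescaled by every \<open>s > \<parallel>T\<parallel>\<close>.\<close>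
  show ?thesis
  proof (rule field_le_epsilon)
    fix e :: real assume e: "e > 0"
    define s where "s = norm T + e"
    have s: "s > 0" "norm T < s" using e by (auto simp: s_def add_nonneg_pos)
    have "norm (\<phi> (inverse s *\<^sub>R T)) \<le> 1"
      using s by (intro unit_ball cstar_scaleR[OF A] T) (simp add: field_simps)
    hence "norm (\<phi> T) \<le> s"
      using s by (simp add: star_hom_scaleR[OF hom T] field_simps)
    thus "norm (\<phi> T) \<le> norm T + e" by (simp add: s_def)
  qed
qed

lemma star_hom_zero: "cstar_subalgebra A \<Longrightarrow> star_hom A B \<phi> \<Longrightarrow> \<phi> 0 = 0"
  using star_hom_add[of A B \<phi> 0 0] cstar_zero by auto

lemma star_hom_diff:
  assumes "cstar_subalgebra A" "star_hom A B \<phi>" "S \<in> A" "T \<in> A"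
  shows "\<phi> (S - T) = \<phi> S - \<phi> T"
proof -
  have "\<phi> (S + (-1) *\<^sub>R T) = \<phi> S + (-1) *\<^sub>R \<phi> T"
    using assms by (metis cstar_scaleR star_hom_add star_hom_scaleR)
  thus ?thesis by simp
qed

lemma cstar_diff:
  assumes "cstar_subalgebra A" "S \<in> A" "T \<in> A"
  shows "S - T \<in> A"
  using cstar_add[OF assms(1,2) cstar_scaleR[OF assms(1,3), of "-1"]] by simp

lemma cstar_sum:
  assumes "cstar_subalgebra A" "\<And>i. i \<in> I \<Longrightarrow> f i \<in> A"
  shows "(\<Sum>i\<in>I. f i) \<in> A"
  using assms(2)
  by (induction I rule: infinite_finite_induct) (auto intro: cstar_zero[OF assms(1)] cstar_add[OF assms(1)])

lemma star_hom_tendsto: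
  assumes A: "cstar_subalgebra A" and B: "cstar_subalgebra B" and hom: "star_hom A B \<phi>"
    and X: "\<And>n. X n \<in> A" "X \<longlonglongrightarrow> T"
  shows "(\<lambda>n. \<phi> (X n)) \<longlonglongrightarrow> \<phi> T"
proof -
  have T: "T \<in> A" using closed_sequentially[OF cstar_closed[OF A]] X by blast
  have "(\<lambda>n. X n - T) \<longlonglongrightarrow> 0" using X(2) by (simp add: LIM_zero)
  hence 0: "(\<lambda>n. norm (X n - T)) \<longlonglongrightarrow> 0" by (rule tendsto_norm_zero)
  have "(\<lambda>n. \<phi> (X n) - \<phi> T) \<longlonglongrightarrow> 0"
  proof (rule Lim_null_comparison[OF _ 0], rule always_eventually, rule allI)
    show "norm (\<phi> (X n) - \<phi> T) \<le> norm (X n - T)" for n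
      using star_hom_contractive[OF A B hom cstar_diff[OF A X(1) T]] star_hom_diff[OF A hom X(1) T]
      by simp
  qed
  thus ?thesis by (simp add: LIM_zero_iff)
qed

text \<open>
  The elements on which two homomorphisms agree form a C*-algebra: being contractive, both are
  continuous, so this set is closed.
\<close>

lemma star_hom_eq_on_Cstar:
  assumes \<gamma>: "range \<gamma> \<subseteq> BH" and B: "cstar_subalgebra B"
    and hom: "star_hom (Cstar \<gamma>) B \<phi>" "star_hom (Cstar \<gamma>) B \<psi>"
    and eq: "\<And>k. \<phi> (\<gamma> k) = \<psi> (\<gamma> k)" and T: "T \<in> Cstar \<gamma>"
  shows "\<phi> T = \<psi> T"
proof -
  note A = cstar_subalgebra_Cstar[OF \<gamma>]
  let ?E = "{T \<in> Cstar \<gamma>. \<phi> T = \<psi> T}"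
  have "closed ?E"
    unfolding closed_sequential_limits
  proof (intro allI impI, elim conjE)
    fix X l assume X: "\<forall>n. X n \<in> ?E" and l: "X \<longlonglongrightarrow> l"
    have "l \<in> Cstar \<gamma>" using closed_sequentially[OF cstar_closed[OF A]] X l by blast
    moreover have "\<phi> l = \<psi> l"
      using star_hom_tendsto[OF A B hom(1) _ l] star_hom_tendsto[OF A B hom(2) _ l] X
      by (auto intro: LIMSEQ_unique)
    ultimately show "l \<in> ?E" by simp
  qed
  hence "cstar_subalgebra ?E"
    unfolding cstar_subalgebra_def
    by (auto simp: star_hom_zero[OF A hom(1)] star_hom_zero[OF A hom(2)] cstar_in_BH[OF A]
        cstar_zero[OF A] cstar_add[OF A] cstar_compose[OF A] cstar_scaleC[OF A] cstar_adj[OF A]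
        star_hom_add[OF hom(1)] star_hom_compose[OF hom(1)] star_hom_scaleC[OF hom(1)] star_hom_adj[OF hom(1)]
        star_hom_add[OF hom(2)] star_hom_compose[OF hom(2)] star_hom_scaleC[OF hom(2)] star_hom_adj[OF hom(2)])
  moreover have "range \<gamma> \<subseteq> ?E" using eq generator_in_Cstar by auto
  ultimately have "Cstar \<gamma> \<subseteq> ?E" by (rule Cstar_minimal)
  thus ?thesis using T by blast
qed

section \<open>The action described by a code\<close>

definition var_poly :: "nat \<Rightarrow> ncpoly" where
  "var_poly k = Abs_ncpoly (Poly_Mapping.single [Var k] 1)"

lemma eval_var_poly: "eval_poly \<gamma> (var_poly k) = \<gamma> k"
proof -
  have "coeffs (var_poly k) = Poly_Mapping.single [Var k] 1"
    unfolding var_poly_def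
    by (rule Abs_ncpoly_inverse) (auto simp: lookup_single when_def)
  thus ?thesis
    by (auto simp: eval_poly_def eval_word_def scaleC_op_apply scaleC_one intro!: blinfun_eqI)
qed

lemma induces_hom_unique:
  assumes \<gamma>: "range \<gamma> \<subseteq> BH" and \<gamma>': "range \<gamma>' \<subseteq> BH"
    and "induces_hom \<gamma> \<gamma>' \<Phi> \<phi>" "induces_hom \<gamma> \<gamma>' \<Phi> \<psi>" "T \<in> Cstar \<gamma>"
  shows "\<phi> T = \<psi> T"
proof (rule star_hom_eq_on_Cstar[OF \<gamma> cstar_subalgebra_Cstar[OF \<gamma>'] _ _ _ assms(5)])
  show "\<phi> (\<gamma> k) = \<psi> (\<gamma> k)" for k
    using assms(3,4) LIMSEQ_unique unfolding induces_hom_def by (metis eval_var_poly)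
qed (use assms in \<open>auto simp: induces_hom_def\<close>)

lemma eval_poly_in_Cstar:
  assumes "range \<gamma> \<subseteq> BH"
  shows "eval_poly \<gamma> p \<in> Cstar \<gamma>"
proof -
  note A = cstar_subalgebra_Cstar[OF assms]
  have letter: "eval_letter \<gamma> l \<in> Cstar \<gamma>" for l
    by (cases l) (auto intro: generator_in_Cstar cstar_adj[OF A])
  have word: "eval_word \<gamma> (l # w) \<in> Cstar \<gamma>" for l w
  proof (induction w arbitrary: l)
    case Nil
    have "eval_letter \<gamma> l o\<^sub>L id_blinfun = eval_letter \<gamma> l" by (rule blinfun_eqI) simp
    thus ?case using letter by (simp add: eval_word_def)
  next
    case (Cons l' w)
    have "eval_word \<gamma> (l # l' # w) = eval_letter \<gamma> l o\<^sub>L eval_word \<gamma> (l' # w)"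
      by (simp add: eval_word_def)
    thus ?case using Cons cstar_compose[OF A letter] by simp
  qed
  have "eval_word \<gamma> w \<in> Cstar \<gamma>" if "w \<in> Poly_Mapping.keys (coeffs p)" for w
  proof (cases w)
    case Nil
    thus ?thesis using that coeffs[of p] by (auto simp: in_keys_iff)
  qed (simp add: word)
  thus ?thesis
    unfolding eval_poly_def by (intro cstar_sum[OF A] cstar_scaleC[OF A])
qed

text \<open>
  A code determines its homomorphism on the generators, hence everywhere, so the description
  operator in \<open>coded_hom\<close> selects the unique extensional one.
\<close>

lemma induces_coded_hom:
  assumes \<gamma>: "range \<gamma> \<subseteq> BH" and \<gamma>': "range \<gamma>' \<subseteq> BH" and "hom_code \<gamma> \<gamma>' \<Phi>"
  shows "induces_hom \<gamma> \<gamma>' \<Phi> (coded_hom \<gamma> \<gamma>' \<Phi>)"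
proof -
  note A = cstar_subalgebra_Cstar[OF \<gamma>]
  obtain \<phi> where \<phi>: "induces_hom \<gamma> \<gamma>' \<Phi> \<phi>" using assms(3) by (auto simp: hom_code_def)
  define \<psi> where "\<psi> = restrict \<phi> (Cstar \<gamma>)"
  have "\<psi> \<in> extensional (Cstar \<gamma>) \<and> induces_hom \<gamma> \<gamma>' \<Phi> \<psi>"
    using \<phi> A unfolding induces_hom_def star_hom_def \<psi>_def
    by (auto simp: cstar_add cstar_compose cstar_scaleC cstar_adj eval_poly_in_Cstar[OF \<gamma>])
  hence "\<exists>!\<psi>. \<psi> \<in> extensional (Cstar \<gamma>) \<and> induces_hom \<gamma> \<gamma>' \<Phi> \<psi>"
    using induces_hom_unique[OF \<gamma> \<gamma>'] by (auto intro: extensionalityI)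
  from theI'[OF this] show ?thesis by (simp add: coded_hom_def)
qed

section \<open>Orthonormal bases and unitaries\<close>

definition orthonormal :: "'i set \<Rightarrow> ('i \<Rightarrow> 'a::chilbert_space) \<Rightarrow> bool" where
  "orthonormal I e \<longleftrightarrow> (\<forall>i\<in>I. \<forall>j\<in>I. cinner (e i) (e j) = (if i = j then 1 else 0))"

definition onb :: "(nat \<Rightarrow> 'a::chilbert_space) \<Rightarrow> bool" where
  "onb e \<longleftrightarrow> orthonormal UNIV e \<and> (\<forall>x. (\<forall>i. cinner x (e i) = 0) \<longrightarrow> x = 0)"

lemma cinner_orthonormal_sum:
  assumes "orthonormal I e" "finite F" "F \<subseteq> I" "j \<in> I"
  shows "cinner (\<Sum>i\<in>F. c i *\<^sub>C e i) (e j) = (if j \<in> F then c j else 0)"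
proof -
  have "cinner (\<Sum>i\<in>F. c i *\<^sub>C e i) (e j) = (\<Sum>i\<in>F. if i = j then c i else 0)"
    unfolding cinner_sum_left cinner_scaleC_left
    using assms by (intro sum.cong) (auto simp: orthonormal_def)
  also have "\<dots> = (if j \<in> F then c j else 0)"
    using assms(2) by simp
  finally show ?thesis .
qed

lemma norm_orthonormal_sum:
  assumes "orthonormal I e" "finite F" "F \<subseteq> I"
  shows "(norm (\<Sum>i\<in>F. c i *\<^sub>C e i))\<^sup>2 = (\<Sum>i\<in>F. (cmod (c i))\<^sup>2)"
proof -
  let ?p = "\<Sum>i\<in>F. c i *\<^sub>C e i"
  have "complex_of_real ((norm ?p)\<^sup>2) = (\<Sum>i\<in>F. c i * cinner (e i) ?p)"
    unfolding cinner_self[symmetric] by (subst cinner_sum_left) (simp add: cinner_scaleC_left)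
  also have "\<dots> = (\<Sum>i\<in>F. c i * cnj (c i))"
  proof (rule sum.cong[OF refl])
    fix i assume "i \<in> F"
    hence "cinner ?p (e i) = c i"
      using cinner_orthonormal_sum[OF assms, of i c] assms(3) by auto
    thus "c i * cinner (e i) ?p = c i * cnj (c i)" by (metis cinner_commute)
  qed
  also have "\<dots> = complex_of_real (\<Sum>i\<in>F. (cmod (c i))\<^sup>2)"
    by (simp only: complex_norm_square[symmetric] of_real_sum)
  finally show ?thesis by (simp only: of_real_eq_iff)
qed

lemma bessel_inequality:
  assumes "orthonormal I e" "finite F" "F \<subseteq> I"
  shows "(\<Sum>i\<in>F. (cmod (cinner x (e i)))\<^sup>2) \<le> (norm x)\<^sup>2"
proof -
  define p where "p = (\<Sum>i\<in>F. cinner x (e i) *\<^sub>C e i)"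
  define s where "s = (\<Sum>i\<in>F. (cmod (cinner x (e i)))\<^sup>2)"
  have "(norm p)\<^sup>2 = s" unfolding p_def s_def by (rule norm_orthonormal_sum[OF assms])
  moreover have "inner p x = s"
  proof -
    have "cinner p x = (\<Sum>i\<in>F. cinner x (e i) * cnj (cinner x (e i)))"
      unfolding p_def cinner_sum_left cinner_scaleC_left by (metis cinner_commute)
    also have "\<dots> = complex_of_real s"
      unfolding s_def by (simp only: complex_norm_square[symmetric] of_real_sum)
    finally show ?thesis by (simp add: inner_eq_Re_cinner)
  qed
  moreover have "0 \<le> (norm (x - p))\<^sup>2" by simp
  moreover have "(norm (x - p))\<^sup>2 = (norm x)\<^sup>2 - 2 * inner p x + (norm p)\<^sup>2"
    unfolding power2_norm_eq_inner by (simp add: inner_diff inner_commute)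
  ultimately show ?thesis unfolding s_def by linarith
qed

lemma onb_orthonormal: "onb e \<Longrightarrow> orthonormal UNIV e"
  by (simp add: onb_def)

lemma onb_eqI:
  assumes "onb e" "\<And>i. cinner x (e i) = cinner y (e i)"
  shows "x = y"
proof -
  have "\<forall>i. cinner (x - y) (e i) = 0" using assms(2) by (simp add: cinner_diff_left)
  hence "x - y = 0" using assms(1) unfolding onb_def by blast
  thus ?thesis by simp
qed

lemma riesz_fischer:
  assumes e: "orthonormal UNIV (e :: nat \<Rightarrow> 'a::chilbert_space)" and c: "summable (\<lambda>i. (cmod (c i))\<^sup>2)"
  shows "\<exists>y. (\<lambda>n. \<Sum>i<n. c i *\<^sub>C e i) \<longlonglongrightarrow> y \<and> (\<forall>j. cinner y (e j) = c j)"
proof -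
  define s where "s n = (\<Sum>i<n. c i *\<^sub>C e i)" for n
  define S where "S n = (\<Sum>i<n. (cmod (c i))\<^sup>2)" for n
  have "Cauchy S"
    using c summable_iff_convergent convergent_Cauchy unfolding S_def by blast
  have diff: "(norm (s n - s m))\<^sup>2 = S n - S m" if "m \<le> n" for m n
  proof -
    have "s n - s m = (\<Sum>i\<in>{m..<n}. c i *\<^sub>C e i)" "S n - S m = (\<Sum>i\<in>{m..<n}. (cmod (c i))\<^sup>2)"
      using sum_diff_nat_ivl[of 0 m n "\<lambda>i. c i *\<^sub>C e i"] sum_diff_nat_ivl[of 0 m n "\<lambda>i. (cmod (c i))\<^sup>2"] that
      by (simp_all add: s_def S_def lessThan_atLeast0)
    thus ?thesis using norm_orthonormal_sum[OF e, of "{m..<n}" c] by simp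
  qed
  have "Cauchy s"
  proof (rule metric_CauchyI)
    fix r :: real assume r: "r > 0"
    then obtain N where N: "\<And>m n. m \<ge> N \<Longrightarrow> n \<ge> N \<Longrightarrow> dist (S m) (S n) < r\<^sup>2"
      using \<open>Cauchy S\<close> by (metis metric_CauchyD zero_less_power)
    have le: "dist (s m) (s n) < r" if "N \<le> m" "m \<le> n" for m n
    proof -
      have "(dist (s m) (s n))\<^sup>2 < r\<^sup>2"
        using diff[OF that(2)] N[of m n] that by (simp add: dist_norm norm_minus_commute)
      thus ?thesis using r by (simp add: power_less_imp_less_base)
    qed
    show "\<exists>N. \<forall>m\<ge>N. \<forall>n\<ge>N. dist (s m) (s n) < r"
      using le by (metis dist_commute nle_le)
  qed
  then obtain y where y: "s \<longlonglongrightarrow> y" using Cauchy_convergent_iff convergent_def by blast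
  have "cinner y (e j) = c j" for j
  proof (rule LIMSEQ_unique)
    show "(\<lambda>n. cinner (s n) (e j)) \<longlonglongrightarrow> cinner y (e j)"
      by (intro tendsto_cinner y tendsto_const)
    have "\<forall>\<^sub>F n in sequentially. cinner (s n) (e j) = c j"
      using eventually_gt_at_top[of j]
      by eventually_elim (simp add: s_def cinner_orthonormal_sum[OF e])
    thus "(\<lambda>n. cinner (s n) (e j)) \<longlonglongrightarrow> c j" by (rule tendsto_eventually)
  qed
  thus ?thesis using y by (auto simp: s_def[abs_def])
qed

lemma summable_bessel:
  assumes "orthonormal UNIV (e :: nat \<Rightarrow> 'a::chilbert_space)"
  shows "summable (\<lambda>i. (cmod (cinner x (e i)))\<^sup>2)"
  by (rule summableI_nonneg_bounded[of _ "(norm x)\<^sup>2"]) (auto intro: bessel_inequality[OF assms])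

lemma onb_expansion:
  assumes "onb e"
  shows "(\<lambda>n. \<Sum>i<n. cinner x (e i) *\<^sub>C e i) \<longlonglongrightarrow> x"
proof -
  obtain y where y: "(\<lambda>n. \<Sum>i<n. cinner x (e i) *\<^sub>C e i) \<longlonglongrightarrow> y" "\<forall>j. cinner y (e j) = cinner x (e j)"
    using riesz_fischer[OF onb_orthonormal[OF assms] summable_bessel[OF onb_orthonormal[OF assms]]]
    by blast
  have "y = x" by (rule onb_eqI[OF assms]) (simp add: y(2))
  thus ?thesis using y(1) by simp
qed

lemma onb_parseval:
  assumes "onb e"
  shows "(\<lambda>n. \<Sum>i<n. cinner x (e i) * cnj (cinner y (e i))) \<longlonglongrightarrow> cinner x y"
proof -
  have "(\<lambda>n. cinner (\<Sum>i<n. cinner x (e i) *\<^sub>C e i) y) \<longlonglongrightarrow> cinner x y"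
    by (intro tendsto_cinner onb_expansion[OF assms] tendsto_const)
  thus ?thesis unfolding cinner_sum_left cinner_scaleC_left by (simp flip: cinner_commute)
qed

definition unitary_pair :: "('b::chilbert_space \<Rightarrow>\<^sub>L 'a::chilbert_space) \<Rightarrow> ('a \<Rightarrow>\<^sub>L 'b) \<Rightarrow> bool" where
  "unitary_pair U V \<longleftrightarrow> (\<forall>x. V (U x) = x) \<and> (\<forall>y. U (V y) = y) \<and> (\<forall>x y. cinner (U x) y = cinner x (V y))"

text \<open>
  By Riesz and Fischer there is a vector with the coefficients of \<open>x\<close> in the other basis. Parseval's
  identity then shows that this correspondence preserves inner products.
\<close>

lemma unitary_pair_exists:
  fixes e :: "nat \<Rightarrow> 'a::chilbert_space" and f :: "nat \<Rightarrow> 'b::chilbert_space"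
  assumes e: "onb e" and f: "onb f"
  shows "\<exists>U V. unitary_pair U V \<and> (\<forall>i. blinfun_apply V (e i) = f i)"
proof -
  have transport: "\<exists>U. bounded_linear U \<and> (\<forall>x i. cinner (U x) (f' i) = cinner x (e' i))"
    if e': "onb e'" and f': "onb f'"
    for e' :: "nat \<Rightarrow> 'c::chilbert_space" and f' :: "nat \<Rightarrow> 'd::chilbert_space"
  proof -
    have "\<exists>y. \<forall>j. cinner y (f' j) = cinner x (e' j)" for x
      using riesz_fischer[OF onb_orthonormal[OF f'] summable_bessel[OF onb_orthonormal[OF e']]] by blast
    then obtain U where U: "\<And>x j. cinner (U x) (f' j) = cinner x (e' j)" by metis
    have "cinner (U x) (U x) = cinner x x" for x
      using LIMSEQ_unique[OF onb_parseval[OF f', of "U x" "U x", unfolded U] onb_parseval[OF e', of x x]] .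
    hence norm: "norm (U x) = norm x" for x
      unfolding cinner_self of_real_eq_iff by simp
    have "bounded_linear U"
    proof
      show "U (x + y) = U x + U y" for x y
        by (rule onb_eqI[OF f']) (simp add: U cinner_add_left)
      show "U (r *\<^sub>R x) = r *\<^sub>R U x" for r x
        by (rule onb_eqI[OF f']) (simp add: U scaleR_eq_scaleC cinner_scaleC_left)
      show "\<exists>K. \<forall>x. norm (U x) \<le> norm x * K"
        using norm by (intro exI[of _ 1]) simp
    qed
    thus ?thesis using U by blast
  qed
  obtain U where U: "bounded_linear U" "\<And>x i. cinner (U x) (e i) = cinner x (f i)"
    using transport[OF f e] by blast
  obtain V where V: "bounded_linear V" "\<And>x i. cinner (V x) (f i) = cinner x (e i)"
    using transport[OF e f] by blast
  have UV: "U (V x) = x" for x by (rule onb_eqI[OF e]) (simp add: U V)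
  have VU: "V (U x) = x" for x by (rule onb_eqI[OF f]) (simp add: U V)
  have "cinner (U x) y = cinner x (V y)" for x y
    using LIMSEQ_unique[OF onb_parseval[OF e, of "U x" y, unfolded U]]
      onb_parseval[OF f, of x "V y", unfolded V] by blast
  moreover have "V (e i) = f i" for i
    using onb_orthonormal[OF e] onb_orthonormal[OF f]
    by (intro onb_eqI[OF f]) (simp add: V orthonormal_def)
  ultimately show ?thesis
    using UV VU by (intro exI[of _ "Blinfun U"] exI[of _ "Blinfun V"])
      (simp add: unitary_pair_def bounded_linear_Blinfun_apply U(1) V(1))
qed

text \<open>
  A maximal orthonormal set is total. Its members have distance \<open>sqrt 2\<close> from each other, so
  choosing close points in a countable dense set shows it to be countable, and it is infinite
  because a finite one would be a vector space basis.
\<close>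

lemma onb_exists:
  assumes inf: "\<nexists>B. finite_dimensional_vector_space (scaleC :: complex \<Rightarrow> 'h::chilbert_space \<Rightarrow> 'h) B"
    and sep: "separable_space (euclidean :: 'h topology)"
  shows "\<exists>e :: nat \<Rightarrow> 'h. onb e"
proof -
  have "\<exists>M\<in>{B. orthonormal B (\<lambda>x::'h. x)}. \<forall>X\<in>{B. orthonormal B (\<lambda>x. x)}. M \<subseteq> X \<longrightarrow> X = M"
  proof (rule subset_Zorn')
    fix C assume C: "subset.chain {B. orthonormal B (\<lambda>x::'h. x)} C"
    have "cinner x y = (if x = y then 1 else 0)" if xy: "x \<in> \<Union>C" "y \<in> \<Union>C" for x y
    proof -
      obtain X Y where XY: "X \<in> C" "x \<in> X" "Y \<in> C" "y \<in> Y" using xy by blast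
      hence "X \<subseteq> Y \<or> Y \<subseteq> X" using C by (auto simp: subset_chain_def)
      then obtain B where "B \<in> C" "x \<in> B" "y \<in> B" using XY by blast
      moreover from this have "orthonormal B (\<lambda>x. x)" using C by (auto simp: subset_chain_def)
      ultimately show ?thesis unfolding orthonormal_def by blast
    qed
    thus "\<Union>C \<in> {B. orthonormal B (\<lambda>x. x)}"
      unfolding orthonormal_def by simp
  qed
  then obtain M :: "'h set" where M: "orthonormal M (\<lambda>x. x)"
    and max: "\<And>X. orthonormal X (\<lambda>x. x) \<Longrightarrow> M \<subseteq> X \<Longrightarrow> X = M" by blast
  have unit: "cinner b b = 1" if "b \<in> M" for b using M that by (simp add: orthonormal_def)
  have total: "x = 0" if x: "\<And>b. b \<in> M \<Longrightarrow> cinner x b = 0" for x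
  proof (rule ccontr)
    assume "x \<noteq> 0"
    define u where "u = complex_of_real (inverse (norm x)) *\<^sub>C x"
    have uu: "cinner u u = 1"
      using \<open>x \<noteq> 0\<close> by (simp add: u_def cinner_self norm_scaleC norm_inverse flip: of_real_mult)
    have ub: "cinner u b = 0" if "b \<in> M" for b
      using x[OF that] by (simp add: u_def cinner_scaleC_left)
    have bu: "cinner b u = 0" if "b \<in> M" for b
      using ub[OF that] by (metis cinner_commute complex_cnj_zero)
    have "u \<notin> M" using ub uu by force
    hence "orthonormal (insert u M) (\<lambda>x. x)"
      using M uu ub bu by (auto simp: orthonormal_def)
    thus False using max[of "insert u M"] \<open>u \<notin> M\<close> by blast
  qed
  have "infinite M"
  proof
    assume fin: "finite M"
    interpret vs: vector_space "scaleC :: complex \<Rightarrow> 'h \<Rightarrow> 'h" by (rule vector_space_scaleC)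
    have coeff: "cinner (\<Sum>b\<in>M. c b *\<^sub>C b) b' = c b'" if "b' \<in> M" for c b'
      using cinner_orthonormal_sum[OF M fin subset_refl that] that by simp
    have "x \<in> vs.span M" for x
    proof -
      have "x - (\<Sum>b\<in>M. cinner x b *\<^sub>C b) = 0"
        by (rule total) (simp add: cinner_diff_left coeff)
      hence "x = (\<Sum>b\<in>M. cinner x b *\<^sub>C b)" by simp
      also have "\<dots> \<in> vs.span M" by (intro vs.span_sum vs.span_scale vs.span_base)
      finally show ?thesis .
    qed
    moreover have "\<not> vs.dependent M"
      unfolding vs.dependent_finite[OF fin] using coeff by (metis cinner_zero_left)
    ultimately have "finite_dimensional_vector_space (scaleC :: complex \<Rightarrow> 'h \<Rightarrow> 'h) M"
      using fin by unfold_locales auto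
    thus False using inf by blast
  qed
  moreover have "countable M"
  proof -
    obtain D :: "'h set" where D: "countable D" "closure D = UNIV"
      using sep by (auto simp: separable_space_def)
    have "\<exists>d\<in>D. dist d b < 1/2" for b
      using closure_approachable[THEN iffD1, rule_format, of b D "1/2"] D(2) by simp
    then obtain g where g: "\<And>b. g b \<in> D" "\<And>b. dist (g b) b < 1/2" by metis
    have "inj_on g M"
    proof (rule inj_onI, rule ccontr)
      fix b c assume bc: "b \<in> M" "c \<in> M" "g b = g c" "b \<noteq> c"
      have "dist b c < 1"
        using g(2)[of b] g(2)[of c] bc(3) dist_triangle_half_r by metis
      have "cinner b c = 0" "cinner c b = 0" using M bc by (auto simp: orthonormal_def)
      hence "cinner (b - c) (b - c) = 2"
        using unit bc by (simp add: cinner_diff_left cinner_diff_right)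
      hence "complex_of_real ((dist b c)\<^sup>2) = of_real 2"
        by (simp only: cinner_self dist_norm of_real_numeral)
      hence "(dist b c)\<^sup>2 = 2" by (simp only: of_real_eq_iff)
      moreover have "(dist b c)\<^sup>2 \<le> 1\<^sup>2"
        using \<open>dist b c < 1\<close> by (intro power_mono) auto
      ultimately show False by simp
    qed
    thus ?thesis
      using D(1) g(1) by (meson countable_image_inj_on countable_subset image_subsetI)
  qed
  ultimately have bij: "bij_betw (from_nat_into M) UNIV M"
    by (intro bij_betw_from_nat_into)
  have "onb (from_nat_into M)"
    unfolding onb_def
  proof
    show "orthonormal UNIV (from_nat_into M)"
    proof -
      have "from_nat_into M i \<in> M" "from_nat_into M i = from_nat_into M j \<longleftrightarrow> i = j" for i j
        using bij by (auto simp: bij_betw_def inj_eq)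
      thus ?thesis using M by (simp add: orthonormal_def)
    qed
    show "\<forall>x. (\<forall>i. cinner x (from_nat_into M i) = 0) \<longrightarrow> x = 0"
      using total bij by (metis bij_betw_imp_surj_on rangeE)
  qed
  thus ?thesis by blast
qed


section \<open>Unitarily equivalent generators\<close>

lemma unitary_pair_swap: "unitary_pair U V \<Longrightarrow> unitary_pair V U"
  unfolding unitary_pair_def by (metis cinner_commute)

lemma unitary_pair_scaleC:
  assumes "unitary_pair U V"
  shows "blinfun_apply U (c *\<^sub>C x) = c *\<^sub>C blinfun_apply U x"
proof (rule cinner_eqI)
  show "cinner (U (c *\<^sub>C x)) y = cinner (c *\<^sub>C U x) y" for y
    using assms by (simp add: unitary_pair_def cinner_scaleC_left)
qed

lemma unitary_pair_norm_le:
  assumes "unitary_pair U V"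
  shows "norm U \<le> 1"
proof (rule norm_blinfun_bound)
  fix x
  have "cinner (U x) (U x) = cinner x x" using assms by (simp add: unitary_pair_def)
  thus "norm (U x) \<le> 1 * norm x" unfolding cinner_self of_real_eq_iff by simp
qed simp

definition conj_op :: "('b::chilbert_space \<Rightarrow>\<^sub>L 'a::chilbert_space) \<Rightarrow> ('a \<Rightarrow>\<^sub>L 'b) \<Rightarrow> ('b \<Rightarrow>\<^sub>L 'b) \<Rightarrow> ('a \<Rightarrow>\<^sub>L 'a)" where
  "conj_op U V T = U o\<^sub>L T o\<^sub>L V"

lemma conj_op_apply: "blinfun_apply (conj_op U V T) x = U (T (V x))"
  by (simp add: conj_op_def)

context
  fixes U :: "'b::chilbert_space \<Rightarrow>\<^sub>L 'a::chilbert_space" and V :: "'a \<Rightarrow>\<^sub>L 'b"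
  assumes UV: "unitary_pair U V"
begin

lemma conj_op_inverse: "conj_op V U (conj_op U V T) = T"
  using UV by (intro blinfun_eqI) (simp add: conj_op_apply unitary_pair_def)

lemma conj_op_in_BH: "T \<in> BH \<Longrightarrow> conj_op U V T \<in> BH"
  unfolding BH_def
  by (simp add: conj_op_apply unitary_pair_scaleC[OF UV] unitary_pair_scaleC[OF unitary_pair_swap[OF UV]])

lemma conj_op_zero: "conj_op U V 0 = 0"
  by (rule blinfun_eqI) (simp add: conj_op_apply)

lemma conj_op_add: "conj_op U V (S + T) = conj_op U V S + conj_op U V T"
  by (rule blinfun_eqI) (simp add: conj_op_apply plus_blinfun.rep_eq blinfun.add_right)

lemma conj_op_scaleC: "conj_op U V (scaleC_op c T) = scaleC_op c (conj_op U V T)"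
  by (rule blinfun_eqI) (simp add: conj_op_apply scaleC_op_apply unitary_pair_scaleC[OF UV])

lemma conj_op_compose: "conj_op U V (S o\<^sub>L T) = conj_op U V S o\<^sub>L conj_op U V T"
  using UV by (intro blinfun_eqI) (simp add: conj_op_apply unitary_pair_def)

lemma conj_op_adj:
  assumes "T \<in> BH"
  shows "conj_op U V (adj T) = adj (conj_op U V T)"
proof (rule adj_eqI[symmetric])
  show "cinner (conj_op U V (adj T) x) y = cinner x (conj_op U V T y)" for x y
    using UV unitary_pair_swap[OF UV]
    by (simp add: conj_op_apply unitary_pair_def cinner_adj_left[OF assms])
qed

lemma norm_conj_op_le: "norm (conj_op U V T) \<le> norm T"
proof -
  have "norm (conj_op U V T) \<le> (norm U * norm T) * norm V"
    unfolding conj_op_def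
    by (intro order_trans[OF norm_blinfun_compose] mult_right_mono norm_blinfun_compose) simp
  also have "\<dots> \<le> (1 * norm T) * 1"
    by (intro mult_mono unitary_pair_norm_le[OF UV] unitary_pair_norm_le[OF unitary_pair_swap[OF UV]]) auto
  finally show ?thesis by simp
qed

lemma tendsto_conj_op: "X \<longlonglongrightarrow> T \<Longrightarrow> (\<lambda>n. conj_op U V (X n)) \<longlonglongrightarrow> conj_op U V T"
  unfolding conj_op_def by (intro bounded_bilinear.tendsto[OF bounded_bilinear_blinfun_compose] tendsto_const)

end

lemma cstar_subalgebra_conj_op:
  assumes UV: "unitary_pair U V" and A: "cstar_subalgebra A"
  shows "cstar_subalgebra (conj_op U V ` A)"
proof -
  note VU = unitary_pair_swap[OF UV]
  have "closed (conj_op U V ` A)"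
    unfolding closed_sequential_limits
  proof (intro allI impI, elim conjE)
    fix X l assume X: "\<forall>n. X n \<in> conj_op U V ` A" and l: "X \<longlonglongrightarrow> l"
    have "conj_op V U (X n) \<in> A" for n
      using X conj_op_inverse[OF UV] by (metis imageE)
    hence "conj_op V U l \<in> A"
      using closed_sequentially[OF cstar_closed[OF A] _ tendsto_conj_op[OF VU l]] by blast
    thus "l \<in> conj_op U V ` A" using conj_op_inverse[OF VU] by (metis imageI)
  qed
  moreover have "conj_op U V ` A \<subseteq> BH" using conj_op_in_BH[OF UV] cstar_in_BH[OF A] by blast
  moreover have "0 \<in> conj_op U V ` A" using conj_op_zero[OF UV] cstar_zero[OF A] by (metis imageI)
  moreover have "\<forall>S\<in>conj_op U V ` A. \<forall>T\<in>conj_op U V ` A. S + T \<in> conj_op U V ` A \<and> S o\<^sub>L T \<in> conj_op U V ` A"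
    by (auto simp: conj_op_add[OF UV, symmetric] conj_op_compose[OF UV, symmetric] cstar_add[OF A] cstar_compose[OF A])
  moreover have "\<forall>c. \<forall>T\<in>conj_op U V ` A. scaleC_op c T \<in> conj_op U V ` A"
    by (auto simp: conj_op_scaleC[OF UV, symmetric] cstar_scaleC[OF A])
  moreover have "\<forall>T\<in>conj_op U V ` A. adj T \<in> conj_op U V ` A"
    by (auto simp: conj_op_adj[OF UV, symmetric] cstar_in_BH[OF A] cstar_adj[OF A])
  ultimately show ?thesis unfolding cstar_subalgebra_def by blast
qed

lemma cstar_isomorphic_conj_op:
  assumes UV: "unitary_pair U V" and \<gamma>: "range \<gamma> \<subseteq> BH"
  shows "cstar_isomorphic (Cstar (\<lambda>n. conj_op U V (\<gamma> n))) (Cstar \<gamma>)"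
proof -
  note VU = unitary_pair_swap[OF UV]
  let ?\<delta> = "\<lambda>n. conj_op U V (\<gamma> n)"
  have \<delta>: "range ?\<delta> \<subseteq> BH" using \<gamma> conj_op_in_BH[OF UV] by blast
  note A = cstar_subalgebra_Cstar[OF \<gamma>] and B = cstar_subalgebra_Cstar[OF \<delta>]
  have "Cstar ?\<delta> \<subseteq> conj_op U V ` Cstar \<gamma>"
    by (intro Cstar_minimal cstar_subalgebra_conj_op UV A) (auto intro: generator_in_Cstar)
  hence 1: "conj_op V U ` Cstar ?\<delta> \<subseteq> Cstar \<gamma>"
    using conj_op_inverse[OF UV] by fastforce
  have 2: "Cstar \<gamma> \<subseteq> conj_op V U ` Cstar ?\<delta>"
  proof (intro Cstar_minimal cstar_subalgebra_conj_op VU B, rule image_subsetI)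
    show "\<gamma> n \<in> conj_op V U ` Cstar ?\<delta>" for n
      using conj_op_inverse[OF UV, of "\<gamma> n", symmetric] generator_in_Cstar[of ?\<delta> n] by (rule image_eqI)
  qed
  have "star_hom (Cstar ?\<delta>) (Cstar \<gamma>) (conj_op V U)"
    using 1 cstar_in_BH[OF B]
    by (simp add: star_hom_def conj_op_add[OF VU] conj_op_compose[OF VU] conj_op_scaleC[OF VU] conj_op_adj[OF VU])
  moreover have "bij_betw (conj_op V U) (Cstar ?\<delta>) (Cstar \<gamma>)"
    using 1 2 conj_op_inverse[OF VU] by (auto simp: bij_betw_def intro: inj_on_inverseI)
  ultimately show ?thesis unfolding cstar_isomorphic_def by blast
qed

section \<open>An orthonormal basis of square-summable sequences\<close>

definition ell2_single :: "nat \<Rightarrow> 'a::chilbert_space \<Rightarrow> 'a ell2" where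
  "ell2_single n x = Abs_ell2 (\<lambda>m. if m = n then x else 0)"

lemma coord_ell2_single: "coord (ell2_single n x) m = (if m = n then x else 0)"
proof -
  have "(\<lambda>m. (norm (if m = n then x else 0))\<^sup>2) = (\<lambda>m. if m = n then (norm x)\<^sup>2 else 0)" by auto
  thus ?thesis by (simp add: ell2_single_def coord_Abs_ell2)
qed

lemma cinner_ell2_single: "cinner \<xi> (ell2_single n x) = cinner (coord \<xi> n) x"
proof -
  have "cinner \<xi> (ell2_single n x) = suminf (\<lambda>m. cinner (coord \<xi> m) (if m = n then x else 0))"
    by (simp add: cinner_ell2_def coord_ell2_single)
  also have "\<dots> = (\<Sum>m\<in>{n}. cinner (coord \<xi> m) (if m = n then x else 0))"
    by (rule suminf_finite) auto
  finally show ?thesis by simp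
qed

definition ell2_basis :: "(nat \<Rightarrow> 'a::chilbert_space) \<Rightarrow> nat \<Rightarrow> 'a ell2" where
  "ell2_basis e k = (case prod_decode k of (n, i) \<Rightarrow> ell2_single n (e i))"

lemma onb_ell2_basis:
  assumes "onb e"
  shows "onb (ell2_basis e)"
  unfolding onb_def
proof
  show "orthonormal UNIV (ell2_basis e)"
  proof -
    have "cinner (ell2_basis e j) (ell2_basis e k) = (if j = k then 1 else 0)" for j k
    proof -
      obtain m i n l where "prod_decode j = (m, i)" "prod_decode k = (n, l)" by fastforce
      moreover from this have "j = k \<longleftrightarrow> m = n \<and> i = l" by (metis Pair_inject prod_decode_inverse)
      ultimately show ?thesis
        using onb_orthonormal[OF assms]
        by (auto simp: ell2_basis_def cinner_ell2_single coord_ell2_single orthonormal_def)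
    qed
    thus ?thesis by (simp add: orthonormal_def)
  qed
  show "\<forall>\<xi>. (\<forall>k. cinner \<xi> (ell2_basis e k) = 0) \<longrightarrow> \<xi> = 0"
  proof (intro allI impI)
    fix \<xi> assume *: "\<forall>k. cinner \<xi> (ell2_basis e k) = 0"
    have "cinner (coord \<xi> n) (e i) = 0" for n i
      using *[rule_format, of "prod_encode (n, i)"] by (simp add: ell2_basis_def cinner_ell2_single)
    hence "coord \<xi> n = 0" for n using assms unfolding onb_def by blast
    thus "\<xi> = 0" by (intro ell2_eqI) (simp add: coord_zero)
  qed
qed

section \<open>The regular representation\<close>

lemma suminf_reindex_bij:
  fixes f :: "nat \<Rightarrow> 'a::banach"
  assumes f: "summable (\<lambda>n. norm (f n))" and b: "bij b"
  shows "summable (\<lambda>n. f (b n))" and "suminf (\<lambda>n. f (b n)) = suminf f"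
proof -
  have "(f has_sum suminf f) UNIV"
    by (rule norm_summable_imp_has_sum[OF f summable_sums[OF summable_norm_cancel[OF f]]])
  hence "((\<lambda>n. f (b n)) has_sum suminf f) UNIV"
    using b by (subst has_sum_reindex_bij_betw)
  hence "(\<lambda>n. f (b n)) sums suminf f" by (rule has_sum_imp_sums)
  thus "summable (\<lambda>n. f (b n))" "suminf (\<lambda>n. f (b n)) = suminf f"
    by (auto simp: sums_iff)
qed

lemma summable_norm_cinner_coord: "summable (\<lambda>n. norm (cinner (coord \<xi> n) (coord \<eta> n)))"
proof (rule summable_comparison_test')
  show "summable (\<lambda>n. (norm (coord \<xi> n))\<^sup>2 + (norm (coord \<eta> n))\<^sup>2)"
    by (intro summable_add summable_coord)
  show "norm (norm (cinner (coord \<xi> n) (coord \<eta> n))) \<le> (norm (coord \<xi> n))\<^sup>2 + (norm (coord \<eta> n))\<^sup>2" for n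
  proof -
    have "norm (norm (cinner (coord \<xi> n) (coord \<eta> n))) \<le> norm (coord \<xi> n) * norm (coord \<eta> n)"
      by (simp add: cmod_cinner_le)
    also have "\<dots> \<le> 2 * norm (coord \<xi> n) * norm (coord \<eta> n)" by simp
    also have "\<dots> \<le> (norm (coord \<xi> n))\<^sup>2 + (norm (coord \<eta> n))\<^sup>2" by (rule sum_squares_bound)
    finally show ?thesis .
  qed
qed

lemma diagonal_operator:
  fixes T :: "nat \<Rightarrow> 'a::chilbert_space \<Rightarrow>\<^sub>L 'a"
  assumes T: "\<And>n. norm (T n) \<le> K"
  defines "D \<equiv> Blinfun (\<lambda>\<xi>. Abs_ell2 (\<lambda>n. T n (coord \<xi> n)))"
  shows "coord (blinfun_apply D \<xi>) n = T n (coord \<xi> n)" and "norm D \<le> K"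
proof -
  have K: "0 \<le> K" using T[of 0] norm_ge_zero order_trans by blast
  have le: "(norm (T n x))\<^sup>2 \<le> K\<^sup>2 * (norm x)\<^sup>2" for n x
  proof -
    have "norm (T n x) \<le> norm (T n) * norm x" by (rule norm_blinfun)
    also have "\<dots> \<le> K * norm x" by (intro mult_right_mono T) simp
    finally have "(norm (T n x))\<^sup>2 \<le> (K * norm x)\<^sup>2" by (intro power_mono) auto
    thus ?thesis by (simp add: power_mult_distrib)
  qed
  have summ: "summable (\<lambda>n. (norm (T n (coord \<xi> n)))\<^sup>2)" for \<xi>
  proof (rule summable_comparison_test')
    show "summable (\<lambda>n. K\<^sup>2 * (norm (coord \<xi> n))\<^sup>2)" by (intro summable_mult summable_coord)
    show "norm ((norm (T n (coord \<xi> n)))\<^sup>2) \<le> K\<^sup>2 * (norm (coord \<xi> n))\<^sup>2" for n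
      using le by simp
  qed
  define f where "f \<xi> = Abs_ell2 (\<lambda>n. T n (coord \<xi> n))" for \<xi>
  have f: "coord (f \<xi>) n = T n (coord \<xi> n)" for \<xi> n
    unfolding f_def by (simp add: coord_Abs_ell2[OF summ])
  have norm: "norm (f \<xi>) \<le> K * norm \<xi>" for \<xi>
  proof -
    have "(norm (f \<xi>))\<^sup>2 \<le> suminf (\<lambda>n. K\<^sup>2 * (norm (coord \<xi> n))\<^sup>2)"
      unfolding norm_sq_ell2 f by (intro suminf_le le summ summable_mult summable_coord)
    also have "\<dots> = (K * norm \<xi>)\<^sup>2"
      by (simp add: suminf_mult summable_coord norm_sq_ell2 power_mult_distrib)
    finally show ?thesis by (rule power2_le_imp_le) (use K in simp)
  qed
  have lin: "bounded_linear f"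
  proof
    show "f (x + y) = f x + f y" for x y
      by (rule ell2_eqI) (simp add: f coord_add blinfun.add_right)
    show "f (r *\<^sub>R x) = r *\<^sub>R f x" for r x
      by (rule ell2_eqI) (simp add: f coord_scaleR blinfun.scaleR_right)
    show "\<exists>K. \<forall>x. norm (f x) \<le> norm x * K"
      using norm by (metis mult.commute)
  qed
  have D: "blinfun_apply D \<xi> = f \<xi>" for \<xi>
    using bounded_linear_Blinfun_apply[OF lin] unfolding D_def f_def[abs_def] by simp
  show "coord (blinfun_apply D \<xi>) n = T n (coord \<xi> n)" by (simp add: D f)
  show "norm D \<le> K" by (rule norm_blinfun_bound[OF K]) (simp add: D norm)
qed

lemma adj_sum:
  assumes "\<And>i. i \<in> I \<Longrightarrow> f i \<in> BH"
  shows "adj (\<Sum>i\<in>I. f i) = (\<Sum>i\<in>I. adj (f i))"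
  using assms
proof (induction I rule: infinite_finite_induct)
  case (insert i I)
  have "(\<Sum>i\<in>I. f i) \<in> BH" using insert.prems by (intro cstar_sum[OF cstar_subalgebra_BH]) auto
  thus ?case using insert by (simp add: adj_add)
qed auto

locale cstar_action = group G
  for G :: "nat monoid" (structure) +
  fixes A :: "('a::chilbert_space \<Rightarrow>\<^sub>L 'a) set" and \<alpha> :: "nat \<Rightarrow> ('a \<Rightarrow>\<^sub>L 'a) \<Rightarrow> ('a \<Rightarrow>\<^sub>L 'a)"
  assumes carrier_UNIV [simp]: "carrier G = UNIV"
    and cstar_A: "cstar_subalgebra A"
    and hom: "star_hom A A (\<alpha> g)"
    and action: "a \<in> A \<Longrightarrow> \<alpha> g (\<alpha> h a) = \<alpha> (g \<otimes> h) a"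
    and action_one: "a \<in> A \<Longrightarrow> \<alpha> \<one> a = a"
begin

abbreviation "\<pi> \<equiv> reg_rep G \<alpha>"
abbreviation \<tau> :: "nat \<Rightarrow> ('a ell2 \<Rightarrow>\<^sub>L 'a ell2)" where "\<tau> \<equiv> left_translation G"

lemma inv_mult_cancel: "inv g \<otimes> (g \<otimes> x) = x" "g \<otimes> (inv g \<otimes> x) = x"
  by (simp_all flip: m_assoc)

lemma bij_mult: "bij (\<lambda>x. g \<otimes> x)"
  by (rule o_bij[of "\<lambda>x. inv g \<otimes> x"]) (auto simp: fun_eq_iff inv_mult_cancel)

lemma action_in: "a \<in> A \<Longrightarrow> \<alpha> g a \<in> A"
  by (rule star_hom_maps[OF hom])

lemma action_contractive: "a \<in> A \<Longrightarrow> norm (\<alpha> g a) \<le> norm a"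
  by (rule star_hom_contractive[OF cstar_A cstar_A hom])

lemma coord_reg_rep: "a \<in> A \<Longrightarrow> coord (blinfun_apply (\<pi> a) \<xi>) g = \<alpha> (inv g) a (coord \<xi> g)"
  unfolding reg_rep_def by (rule diagonal_operator(1)) (rule action_contractive)

lemma norm_reg_rep_le: "a \<in> A \<Longrightarrow> norm (\<pi> a) \<le> norm a"
  unfolding reg_rep_def by (rule diagonal_operator(2)) (rule action_contractive)

lemma reg_rep_add: "a \<in> A \<Longrightarrow> b \<in> A \<Longrightarrow> \<pi> (a + b) = \<pi> a + \<pi> b"
  by (rule blinfun_eqI, rule ell2_eqI)
     (simp add: coord_reg_rep cstar_add[OF cstar_A] star_hom_add[OF hom] plus_blinfun.rep_eq coord_add)

lemma reg_rep_scaleC: "a \<in> A \<Longrightarrow> \<pi> (scaleC_op c a) = scaleC_op c (\<pi> a)"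
  by (rule blinfun_eqI, rule ell2_eqI)
     (simp add: coord_reg_rep cstar_scaleC[OF cstar_A] star_hom_scaleC[OF hom] scaleC_op_apply coord_scaleC)

lemma reg_rep_compose: "a \<in> A \<Longrightarrow> b \<in> A \<Longrightarrow> \<pi> (a o\<^sub>L b) = \<pi> a o\<^sub>L \<pi> b"
  by (rule blinfun_eqI, rule ell2_eqI)
     (simp add: coord_reg_rep cstar_compose[OF cstar_A] star_hom_compose[OF hom])

lemma reg_rep_zero: "\<pi> 0 = 0"
  using norm_reg_rep_le[OF cstar_zero[OF cstar_A]] by simp

lemma reg_rep_in_BH: "a \<in> A \<Longrightarrow> \<pi> a \<in> BH"
  unfolding BH_def
  by (intro CollectI allI ell2_eqI)
     (simp add: coord_reg_rep coord_scaleC BH_apply[OF cstar_in_BH[OF cstar_A action_in]])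

lemma reg_rep_adj:
  assumes "a \<in> A"
  shows "adj (\<pi> a) = \<pi> (adj a)"
proof (rule adj_eqI)
  show "cinner (\<pi> (adj a) \<xi>) \<eta> = cinner \<xi> (\<pi> a \<eta>)" for \<xi> \<eta>
    unfolding cinner_ell2_def
    by (simp add: coord_reg_rep assms cstar_adj[OF cstar_A] star_hom_adj[OF hom]
        cinner_adj_left[OF cstar_in_BH[OF cstar_A action_in]])
qed

lemma coord_left_translation: "coord (blinfun_apply (\<tau> h) \<xi>) g = coord \<xi> (inv h \<otimes> g)"
  and norm_left_translation_le: "norm (\<tau> h) \<le> 1"
proof -
  have summ: "summable (\<lambda>g. (norm (coord \<xi> (inv h \<otimes> g)))\<^sup>2)"
    and norm_eq: "suminf (\<lambda>g. (norm (coord \<xi> (inv h \<otimes> g)))\<^sup>2) = (norm \<xi>)\<^sup>2" for \<xi> :: "'a ell2"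
    using suminf_reindex_bij[OF _ bij_mult, of "\<lambda>g. (norm (coord \<xi> g))\<^sup>2" "inv h"] summable_coord[of \<xi>]
    by (simp_all add: norm_sq_ell2)
  define f where "f \<xi> = Abs_ell2 (\<lambda>g. coord \<xi> (inv h \<otimes> g))" for \<xi> :: "'a ell2"
  have f: "coord (f \<xi>) g = coord \<xi> (inv h \<otimes> g)" for \<xi> g
    unfolding f_def by (simp add: coord_Abs_ell2[OF summ])
  have "(norm (f \<xi>))\<^sup>2 = (norm \<xi>)\<^sup>2" for \<xi>
    using norm_eq by (simp add: norm_sq_ell2 f)
  hence norm: "norm (f \<xi>) = norm \<xi>" for \<xi> by (simp add: power2_eq_iff_nonneg)
  have lin: "bounded_linear f"
  proof
    show "f (x + y) = f x + f y" for x y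
      by (rule ell2_eqI) (simp add: f coord_add)
    show "f (r *\<^sub>R x) = r *\<^sub>R f x" for r x
      by (rule ell2_eqI) (simp add: f coord_scaleR)
    show "\<exists>K. \<forall>x. norm (f x) \<le> norm x * K"
      using norm by (intro exI[of _ 1]) simp
  qed
  have D: "blinfun_apply (\<tau> h) \<xi> = f \<xi>" for \<xi>
    using bounded_linear_Blinfun_apply[OF lin] unfolding left_translation_def f_def[abs_def] by simp
  show "coord (blinfun_apply (\<tau> h) \<xi>) g = coord \<xi> (inv h \<otimes> g)" by (simp add: D f)
  show "norm (\<tau> h) \<le> 1" by (rule norm_blinfun_bound) (simp_all add: D norm)
qed

lemma left_translation_mult: "\<tau> g o\<^sub>L \<tau> h = \<tau> (g \<otimes> h)"
  by (rule blinfun_eqI, rule ell2_eqI) (simp add: coord_left_translation inv_mult_group m_assoc)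

lemma left_translation_one: "\<tau> \<one> = id_blinfun"
  by (rule blinfun_eqI, rule ell2_eqI) (simp add: coord_left_translation)

lemma left_translation_in_BH: "\<tau> h \<in> BH"
  unfolding BH_def by (intro CollectI allI ell2_eqI) (simp add: coord_left_translation coord_scaleC)

lemma left_translation_adj: "adj (\<tau> h) = \<tau> (inv h)"
proof (rule adj_eqI)
  fix \<xi> \<eta> :: "'a ell2"
  let ?f = "\<lambda>g. cinner (coord \<xi> (h \<otimes> g)) (coord \<eta> g)"
  have "summable (\<lambda>g. norm (?f g))"
    using summable_norm_cinner_coord[of "\<tau> (inv h) \<xi>" \<eta>] by (simp add: coord_left_translation)
  from suminf_reindex_bij(2)[OF this bij_mult[of "inv h"]]
  show "cinner (\<tau> (inv h) \<xi>) \<eta> = cinner \<xi> (\<tau> h \<eta>)"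
    by (simp add: cinner_ell2_def coord_left_translation inv_mult_cancel)
qed

lemma covariance:
  assumes "a \<in> A"
  shows "\<tau> g o\<^sub>L \<pi> a = \<pi> (\<alpha> g a) o\<^sub>L \<tau> g"
  by (rule blinfun_eqI, rule ell2_eqI)
     (simp add: coord_left_translation coord_reg_rep assms action_in action inv_mult_group)

section \<open>Generators of the reduced crossed product\<close>

definition term_op :: "('a \<Rightarrow>\<^sub>L 'a) \<Rightarrow> nat \<Rightarrow> ('a ell2 \<Rightarrow>\<^sub>L 'a ell2)" where
  "term_op a g = \<pi> a o\<^sub>L \<tau> g"

lemma term_op_in_BH: "a \<in> A \<Longrightarrow> term_op a g \<in> BH"
  unfolding term_op_def by (intro compose_in_BH reg_rep_in_BH left_translation_in_BH)

lemma term_op_zero: "term_op 0 g = 0"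
  by (simp add: term_op_def reg_rep_zero bounded_bilinear.zero_left[OF bounded_bilinear_blinfun_compose])

lemma term_op_add: "a \<in> A \<Longrightarrow> b \<in> A \<Longrightarrow> term_op (a + b) g = term_op a g + term_op b g"
  by (simp add: term_op_def reg_rep_add bounded_bilinear.add_left[OF bounded_bilinear_blinfun_compose])

lemma term_op_scaleC: "a \<in> A \<Longrightarrow> term_op (scaleC_op c a) g = scaleC_op c (term_op a g)"
  by (rule blinfun_eqI) (simp add: term_op_def reg_rep_scaleC scaleC_op_apply)

lemma term_op_mult:
  assumes "a \<in> A" "b \<in> A"
  shows "term_op a g o\<^sub>L term_op b h = term_op (a o\<^sub>L \<alpha> g b) (g \<otimes> h)"
proof -
  have "term_op a g o\<^sub>L term_op b h = \<pi> a o\<^sub>L (\<tau> g o\<^sub>L \<pi> b) o\<^sub>L \<tau> h"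
    by (rule blinfun_eqI) (simp add: term_op_def)
  also have "\<dots> = (\<pi> a o\<^sub>L \<pi> (\<alpha> g b)) o\<^sub>L (\<tau> g o\<^sub>L \<tau> h)"
    unfolding covariance[OF assms(2)] by (rule blinfun_eqI) simp
  finally show ?thesis
    by (simp add: term_op_def reg_rep_compose assms action_in left_translation_mult)
qed

lemma term_op_adj:
  assumes "a \<in> A"
  shows "adj (term_op a g) = term_op (\<alpha> (inv g) (adj a)) (inv g)"
  unfolding term_op_def
  by (simp add: adj_compose reg_rep_in_BH left_translation_in_BH assms reg_rep_adj left_translation_adj
      covariance cstar_adj[OF cstar_A])

lemma norm_term_op_le: "a \<in> A \<Longrightarrow> norm (term_op a g) \<le> norm a"
proof -
  assume a: "a \<in> A"
  have "norm (term_op a g) \<le> norm (\<pi> a) * norm (\<tau> g)"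
    unfolding term_op_def by (rule norm_blinfun_compose)
  also have "\<dots> \<le> norm a * 1"
    by (intro mult_mono norm_reg_rep_le a norm_left_translation_le) auto
  finally show ?thesis by simp
qed

lemma tendsto_term_op:
  assumes X: "\<And>n. X n \<in> A" "X \<longlonglongrightarrow> a"
  shows "(\<lambda>n. term_op (X n) g) \<longlonglongrightarrow> term_op a g"
proof -
  have a: "a \<in> A" using closed_sequentially[OF cstar_closed[OF cstar_A]] X by blast
  have "(\<lambda>n. X n - a) \<longlonglongrightarrow> 0" using X(2) by (simp add: LIM_zero)
  hence 0: "(\<lambda>n. norm (X n - a)) \<longlonglongrightarrow> 0" by (rule tendsto_norm_zero)
  have "(\<lambda>n. term_op (X n) g - term_op a g) \<longlonglongrightarrow> 0"
  proof (rule Lim_null_comparison[OF _ 0], rule always_eventually, rule allI)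
    fix n
    have d: "X n - a \<in> A" by (rule cstar_diff[OF cstar_A X(1) a])
    have "term_op (X n) g - term_op a g = term_op (X n - a) g"
      using term_op_add[OF d a, of g] by simp
    thus "norm (term_op (X n) g - term_op a g) \<le> norm (X n - a)"
      using norm_term_op_le[OF d] by simp
  qed
  thus ?thesis by (simp add: LIM_zero_iff)
qed

definition finite_sums :: "('a ell2 \<Rightarrow>\<^sub>L 'a ell2) set" where
  "finite_sums = {\<Sum>g\<in>F. term_op (a g) g | F a. finite F \<and> a ` F \<subseteq> A}"

lemma reduced_crossed_product_eq: "reduced_crossed_product A \<alpha> G = closure finite_sums"
  by (simp add: reduced_crossed_product_def finite_sums_def term_op_def)

text \<open>Extending \<open>a\<close> by zero frees later arguments from tracking the support.\<close>

lemma finite_sums_total: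
  assumes "T \<in> finite_sums"
  shows "\<exists>F a. finite F \<and> (\<forall>g. a g \<in> A) \<and> T = (\<Sum>g\<in>F. term_op (a g) g)"
proof -
  obtain F a where F: "finite F" "a ` F \<subseteq> A" "T = (\<Sum>g\<in>F. term_op (a g) g)"
    using assms unfolding finite_sums_def by blast
  have "(if g \<in> F then a g else 0) \<in> A" for g using F(2) cstar_zero[OF cstar_A] by auto
  moreover have "T = (\<Sum>g\<in>F. term_op (if g \<in> F then a g else 0) g)" using F(3) by simp
  ultimately show ?thesis using F(1) by (intro exI[of _ F] exI[of _ "\<lambda>g. if g \<in> F then a g else 0"]) blast
qed

lemma term_op_in_finite_sums:
  assumes "a \<in> A"
  shows "term_op a g \<in> finite_sums"
proof -
  have "term_op a g = (\<Sum>g\<in>{g}. term_op a g)" by simp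
  thus ?thesis
    unfolding finite_sums_def using assms
    by (intro CollectI exI[of _ "{g}"] exI[of _ "\<lambda>_. a"]) auto
qed

lemma finite_sums_add:
  assumes "S \<in> finite_sums" "T \<in> finite_sums"
  shows "S + T \<in> finite_sums"
proof -
  obtain F a where F: "finite F" "\<And>g. a g \<in> A" "S = (\<Sum>g\<in>F. term_op (a g) g)"
    using finite_sums_total[OF assms(1)] by blast
  obtain E b where E: "finite E" "\<And>g. b g \<in> A" "T = (\<Sum>g\<in>E. term_op (b g) g)"
    using finite_sums_total[OF assms(2)] by blast
  define a' where "a' g = (if g \<in> F then a g else 0)" for g
  define b' where "b' g = (if g \<in> E then b g else 0)" for g
  have A: "a' g \<in> A" "b' g \<in> A" for g using F(2) E(2) cstar_zero[OF cstar_A] by (auto simp: a'_def b'_def)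
  have "S = (\<Sum>g\<in>F \<union> E. term_op (a' g) g)"
    unfolding F(3) using F(1) E(1) by (intro sum.mono_neutral_cong_left) (auto simp: a'_def term_op_zero)
  moreover have "T = (\<Sum>g\<in>F \<union> E. term_op (b' g) g)"
    unfolding E(3) using F(1) E(1) by (intro sum.mono_neutral_cong_left) (auto simp: b'_def term_op_zero)
  ultimately have "S + T = (\<Sum>g\<in>F \<union> E. term_op (a' g + b' g) g)"
    by (simp add: term_op_add A sum.distrib)
  thus ?thesis
    unfolding finite_sums_def using F(1) E(1) A cstar_add[OF cstar_A]
    by (intro CollectI exI[of _ "F \<union> E"] exI[of _ "\<lambda>g. a' g + b' g"]) auto
qed

lemma finite_sums_zero: "0 \<in> finite_sums"
  unfolding finite_sums_def by (intro CollectI exI[of _ "{}"]) auto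

lemma finite_sums_sum: "(\<And>i. i \<in> I \<Longrightarrow> f i \<in> finite_sums) \<Longrightarrow> (\<Sum>i\<in>I. f i) \<in> finite_sums"
  by (induction I rule: infinite_finite_induct) (auto intro: finite_sums_zero finite_sums_add)

lemma cstar_subalgebra_crossed_product: "cstar_subalgebra (reduced_crossed_product A \<alpha> G)"
  unfolding reduced_crossed_product_eq
proof (rule cstar_subalgebra_closure)
  show "finite_sums \<subseteq> BH"
  proof
    fix T assume "T \<in> finite_sums"
    then obtain F a where F: "finite F" "\<And>g. a g \<in> A" "T = (\<Sum>g\<in>F. term_op (a g) g)"
      using finite_sums_total by blast
    show "T \<in> BH" unfolding F(3) by (intro cstar_sum[OF cstar_subalgebra_BH] term_op_in_BH F(2))
  qed
  show "scaleC_op c T \<in> finite_sums" if T: "T \<in> finite_sums" for c T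
  proof -
    obtain F a where F: "finite F" "\<And>g. a g \<in> A" "T = (\<Sum>g\<in>F. term_op (a g) g)"
      using finite_sums_total[OF T] by blast
    have "scaleC_op c T = (\<Sum>g\<in>F. term_op (scaleC_op c (a g)) g)"
      unfolding F(3) by (simp add: linear_sum[OF bounded_linear.linear[OF bounded_linear_scaleC_op]] term_op_scaleC F(2))
    thus ?thesis by (simp add: finite_sums_sum term_op_in_finite_sums cstar_scaleC[OF cstar_A] F(2))
  qed
  show "adj T \<in> finite_sums" if T: "T \<in> finite_sums" for T
  proof -
    obtain F a where F: "finite F" "\<And>g. a g \<in> A" "T = (\<Sum>g\<in>F. term_op (a g) g)"
      using finite_sums_total[OF T] by blast
    show ?thesis
      unfolding F(3)
      by (simp add: adj_sum term_op_in_BH F(2) term_op_adj finite_sums_sum term_op_in_finite_sums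
          action_in cstar_adj[OF cstar_A])
  qed
  show "S o\<^sub>L T \<in> finite_sums" if S: "S \<in> finite_sums" and T: "T \<in> finite_sums" for S T
  proof -
    obtain F a where F: "finite F" "\<And>g. a g \<in> A" "S = (\<Sum>g\<in>F. term_op (a g) g)"
      using finite_sums_total[OF S] by blast
    obtain E b where E: "finite E" "\<And>g. b g \<in> A" "T = (\<Sum>g\<in>E. term_op (b g) g)"
      using finite_sums_total[OF T] by blast
    have "S o\<^sub>L T = (\<Sum>h\<in>E. \<Sum>g\<in>F. term_op (a g) g o\<^sub>L term_op (b h) h)"
      unfolding F(3) E(3)
      by (simp add: bounded_bilinear.sum_left[OF bounded_bilinear_blinfun_compose]
          bounded_bilinear.sum_right[OF bounded_bilinear_blinfun_compose])
    thus ?thesis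
      by (simp add: term_op_mult F(2) E(2) finite_sums_sum term_op_in_finite_sums
          action_in cstar_compose[OF cstar_A])
  qed
qed (auto intro: finite_sums_zero finite_sums_add)

text \<open>
  The translates \<open>\<alpha> h (\<gamma> k)\<close> of the generators are included so that the elements \<open>a\<close> all of
  whose \<open>term_op (\<alpha> h a) g\<close> belong to the generated algebra form a C*-algebra: closure under
  the adjoint replaces \<open>h\<close> by \<open>inv g \<otimes> h\<close>.
\<close>

definition crossed_generators :: "(nat \<Rightarrow> 'a \<Rightarrow>\<^sub>L 'a) \<Rightarrow> nat \<Rightarrow> ('a ell2 \<Rightarrow>\<^sub>L 'a ell2)" where
  "crossed_generators \<gamma> n =
     (case prod_decode n of (k, m) \<Rightarrow> case prod_decode m of (h, g) \<Rightarrow> term_op (\<alpha> h (\<gamma> k)) g)"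

text \<open>
  Once every \<open>a \<in> A\<close> is known to satisfy the condition defining \<open>S\<close>, taking \<open>h\<close> to be the unit puts
  all finite sums into the generated algebra.
\<close>

lemma Cstar_crossed_generators:
  assumes A: "A = Cstar \<gamma>"
  shows "Cstar (crossed_generators \<gamma>) = reduced_crossed_product A \<alpha> G"
    and "range (crossed_generators \<gamma>) \<subseteq> BH"
proof -
  have \<gamma>: "\<gamma> k \<in> A" for k unfolding A by (rule generator_in_Cstar)
  have gen: "\<exists>k h g. crossed_generators \<gamma> n = term_op (\<alpha> h (\<gamma> k)) g" for n
    by (auto simp: crossed_generators_def split: prod.split)
  show BH: "range (crossed_generators \<gamma>) \<subseteq> BH"
  proof (rule image_subsetI)
    show "crossed_generators \<gamma> n \<in> BH" for n
      using gen[of n] \<gamma> action_in term_op_in_BH by metis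
  qed
  define D where "D = Cstar (crossed_generators \<gamma>)"
  have D: "cstar_subalgebra D" unfolding D_def by (rule cstar_subalgebra_Cstar[OF BH])
  have in_D: "term_op (\<alpha> h (\<gamma> k)) g \<in> D" for h k g
    using generator_in_Cstar[of "crossed_generators \<gamma>" "prod_encode (k, prod_encode (h, g))"]
    by (simp add: D_def crossed_generators_def)
  define S where "S = {a \<in> A. \<forall>h g. term_op (\<alpha> h a) g \<in> D}"
  have "cstar_subalgebra S"
    unfolding cstar_subalgebra_def
  proof (intro conjI allI ballI)
    show "S \<subseteq> BH" using cstar_in_BH[OF cstar_A] by (auto simp: S_def)
    show "0 \<in> S"
      using cstar_zero[OF cstar_A] cstar_zero[OF D]
      by (simp add: S_def star_hom_zero[OF cstar_A hom] term_op_zero)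
    show "closed S"
      unfolding closed_sequential_limits
    proof (intro allI impI, elim conjE)
      fix X a assume X: "\<forall>n. X n \<in> S" and a: "X \<longlonglongrightarrow> a"
      have XA: "X n \<in> A" for n using X by (simp add: S_def)
      have "term_op (\<alpha> h a) g \<in> D" for h g
      proof (rule closed_sequentially[OF cstar_closed[OF D]])
        show "term_op (\<alpha> h (X n)) g \<in> D" for n using X by (simp add: S_def)
        show "(\<lambda>n. term_op (\<alpha> h (X n)) g) \<longlonglongrightarrow> term_op (\<alpha> h a) g"
          by (intro tendsto_term_op action_in XA star_hom_tendsto[OF cstar_A cstar_A hom] a)
      qed
      thus "a \<in> S" using closed_sequentially[OF cstar_closed[OF cstar_A] XA a] by (simp add: S_def)
    qed
    fix a assume a: "a \<in> S"
    hence aA: "a \<in> A" and aD: "\<And>h g. term_op (\<alpha> h a) g \<in> D" by (auto simp: S_def)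
    show "scaleC_op c a \<in> S" for c
      by (simp add: S_def cstar_scaleC[OF cstar_A] cstar_scaleC[OF D] aA aD star_hom_scaleC[OF hom]
          term_op_scaleC action_in)
    show "adj a \<in> S"
    proof -
      have "term_op (\<alpha> h (adj a)) g = adj (term_op (\<alpha> (inv g \<otimes> h) a) (inv g))" for h g
        by (simp add: term_op_adj action_in aA star_hom_adj[OF hom, symmetric] action
            cstar_adj[OF cstar_A] inv_mult_cancel)
      thus ?thesis by (simp add: S_def cstar_adj[OF cstar_A] cstar_adj[OF D] aA aD)
    qed
    fix b assume b: "b \<in> S"
    hence bA: "b \<in> A" and bD: "\<And>h g. term_op (\<alpha> h b) g \<in> D" by (auto simp: S_def)
    show "a + b \<in> S"
      by (simp add: S_def cstar_add[OF cstar_A] cstar_add[OF D] aA aD bA bD star_hom_add[OF hom]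
          term_op_add action_in)
    show "a o\<^sub>L b \<in> S"
    proof -
      have "term_op (\<alpha> h (a o\<^sub>L b)) g = term_op (\<alpha> h a) \<one> o\<^sub>L term_op (\<alpha> h b) g" for h g
        by (simp add: term_op_mult action_in aA bA star_hom_compose[OF hom] action action_one)
      thus ?thesis
        by (simp add: S_def cstar_compose[OF cstar_A] cstar_compose[OF D] aA aD bA bD)
    qed
  qed
  moreover have "range \<gamma> \<subseteq> S" using \<gamma> in_D by (auto simp: S_def)
  ultimately have "A \<subseteq> S" unfolding A by (rule Cstar_minimal)
  hence term_in_D: "term_op a g \<in> D" if "a \<in> A" for a g
    using that action_one[OF that] unfolding S_def by (metis (mono_tags, lifting) mem_Collect_eq subsetD)
  have "finite_sums \<subseteq> D"
  proof
    fix T assume "T \<in> finite_sums"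
    then obtain F a where F: "finite F" "\<And>g. a g \<in> A" "T = (\<Sum>g\<in>F. term_op (a g) g)"
      using finite_sums_total by blast
    show "T \<in> D" unfolding F(3) by (intro cstar_sum[OF D] term_in_D F(2))
  qed
  hence "reduced_crossed_product A \<alpha> G \<subseteq> D"
    unfolding reduced_crossed_product_eq by (rule closure_minimal[OF _ cstar_closed[OF D]])
  moreover have "D \<subseteq> reduced_crossed_product A \<alpha> G"
    unfolding D_def
  proof (rule Cstar_minimal[OF cstar_subalgebra_crossed_product], rule image_subsetI)
    fix n
    have "crossed_generators \<gamma> n \<in> finite_sums"
      using gen[of n] \<gamma> action_in term_op_in_finite_sums by metis
    thus "crossed_generators \<gamma> n \<in> reduced_crossed_product A \<alpha> G"
      unfolding reduced_crossed_product_eq using closure_subset by blast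
  qed
  ultimately show "Cstar (crossed_generators \<gamma>) = reduced_crossed_product A \<alpha> G"
    unfolding D_def by simp
qed

end

section \<open>Borel structure of the unit ball\<close>

lemma space_borel_of: "space (borel_of X) = topspace X"
  unfolding borel_of_def by (rule space_measure_of) (auto dest: openin_subset)

lemma openin_in_borel_of: "openin X S \<Longrightarrow> S \<in> sets (borel_of X)"
  unfolding borel_of_def by (subst sets_measure_of) (auto dest: openin_subset)

lemma topspace_wot: "topspace wot_unit_ball = unit_ball_BH"
  unfolding wot_unit_ball_def by (simp add: topspace_pullback_topology)

lemma measurable_matrix_coefficient:
  "(\<lambda>T. cinner (blinfun_apply T x) y) \<in> borel_measurable (borel_of wot_unit_ball)"
proof (rule borel_measurableI)
  fix S :: "complex set" assume S: "open S"
  let ?W = "\<lambda>T (x, y). cinner (blinfun_apply T x) y"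
  have "open ((\<lambda>\<phi>. \<phi> (x, y)) -` S)"
    by (rule open_vimage[OF S continuous_on_product_coordinates])
  hence "openin wot_unit_ball (?W -` ((\<lambda>\<phi>. \<phi> (x, y)) -` S) \<inter> unit_ball_BH)"
    unfolding wot_unit_ball_def openin_pullback_topology by (metis open_openin)
  moreover have "?W -` ((\<lambda>\<phi>. \<phi> (x, y)) -` S) \<inter> unit_ball_BH
      = (\<lambda>T. cinner (blinfun_apply T x) y) -` S \<inter> space (borel_of wot_unit_ball)"
    by (auto simp: space_borel_of topspace_wot)
  ultimately show "(\<lambda>T. cinner (blinfun_apply T x) y) -` S \<inter> space (borel_of wot_unit_ball)
      \<in> sets (borel_of wot_unit_ball)"
    by (metis openin_in_borel_of)
qed

definition matrix_of :: "(nat \<Rightarrow> 'a::chilbert_space) \<Rightarrow> ('a \<Rightarrow>\<^sub>L 'a) \<Rightarrow> nat \<times> nat \<Rightarrow> complex" where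
  "matrix_of e T = (\<lambda>(i, j). cinner (blinfun_apply T (e i)) (e j))"

text \<open>
  On the unit ball a matrix coefficient is a uniform limit of finite combinations of the
  coefficients with respect to an orthonormal basis, since \<open>x\<close> and \<open>y\<close> can be replaced by
  finite partial sums of their expansions.
\<close>

lemma continuous_map_matrix_coefficient:
  assumes e: "onb e"
  shows "continuous_map (pullback_topology unit_ball_BH (matrix_of e) euclidean) euclidean
           (\<lambda>T. cinner (blinfun_apply T x) y)"
proof -
  let ?C = "pullback_topology unit_ball_BH (matrix_of e) euclidean"
  define xs where "xs n = (\<Sum>i<n. cinner x (e i) *\<^sub>C e i)" for n
  define ys where "ys n = (\<Sum>i<n. cinner y (e i) *\<^sub>C e i)" for n
  have xs: "xs \<longlonglongrightarrow> x" and ys: "ys \<longlonglongrightarrow> y"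
    unfolding xs_def ys_def by (rule onb_expansion[OF e])+
  have cont: "continuous_map ?C euclidean (\<lambda>T. cinner (blinfun_apply T (xs n)) (ys n))" for n
  proof -
    define g where "g \<phi> = (\<Sum>i<n. \<Sum>j<n. cinner x (e i) * (cnj (cinner y (e j)) * \<phi> (i, j)))"
      for \<phi> :: "nat \<times> nat \<Rightarrow> complex"
    have "continuous_on UNIV g"
      unfolding g_def by (intro continuous_intros) simp
    hence "continuous_map ?C euclidean (g \<circ> matrix_of e)"
      by (intro continuous_map_pullback) simp
    moreover have "(g \<circ> matrix_of e) T = cinner (blinfun_apply T (xs n)) (ys n)" if "T \<in> topspace ?C" for T
    proof -
      have T: "T \<in> BH" using that by (simp add: topspace_pullback_topology unit_ball_BH_def)
      have ys_sum: "cinner z (ys n) = (\<Sum>j<n. cnj (cinner y (e j)) * cinner z (e j))" for z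
        unfolding ys_def
        by (simp add: bounded_bilinear.sum_right[OF bounded_bilinear_cinner] cinner_scaleC_right)
      have xs_sum: "cinner (blinfun_apply T (xs n)) w = (\<Sum>i<n. cinner x (e i) * cinner (blinfun_apply T (e i)) w)" for w
        unfolding xs_def by (simp add: blinfun.sum_right BH_apply[OF T] cinner_sum_left cinner_scaleC_left)
      show ?thesis
        unfolding xs_sum[of "ys n"] by (simp add: ys_sum g_def matrix_of_def sum_distrib_left)
    qed
    ultimately show ?thesis by (rule continuous_map_eq)
  qed
  have bound: "dist (cinner (blinfun_apply T (xs n)) (ys n)) (cinner (blinfun_apply T x) y)
      \<le> norm (xs n - x) * norm (ys n) + norm x * norm (ys n - y)" if "T \<in> topspace ?C" for T n
  proof -
    have T: "norm T \<le> 1" using that by (simp add: topspace_pullback_topology unit_ball_BH_def)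
    have Tz: "norm (blinfun_apply T z) \<le> norm z" for z
      using norm_blinfun[of T z] mult_right_mono[OF T, of "norm z"] by simp
    have "cinner (blinfun_apply T (xs n)) (ys n) - cinner (blinfun_apply T x) y
        = cinner (blinfun_apply T (xs n - x)) (ys n) + cinner (blinfun_apply T x) (ys n - y)"
      by (simp add: blinfun.diff_right cinner_diff_left cinner_diff_right)
    also have "norm \<dots> \<le> norm (blinfun_apply T (xs n - x)) * norm (ys n)
        + norm (blinfun_apply T x) * norm (ys n - y)"
      by (intro order_trans[OF norm_triangle_ineq] add_mono cmod_cinner_le)
    also have "\<dots> \<le> norm (xs n - x) * norm (ys n) + norm x * norm (ys n - y)"
      by (intro add_mono mult_right_mono Tz) auto
    finally show ?thesis by (simp add: dist_norm)
  qed
  have lim: "(\<lambda>n. norm (xs n - x) * norm (ys n) + norm x * norm (ys n - y)) \<longlonglongrightarrow> 0 * norm y + norm x * 0"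
    using xs ys by (intro tendsto_intros tendsto_norm_zero) (simp_all add: LIM_zero)
  have "continuous_map ?C Met_TC.mtopology (\<lambda>T. cinner (blinfun_apply T x) y)"
  proof (rule Met_TC.continuous_map_uniform_limit[where F = sequentially])
    show "\<forall>\<^sub>F n in sequentially. continuous_map ?C Met_TC.mtopology (\<lambda>T. cinner (blinfun_apply T (xs n)) (ys n))"
      using cont by (simp add: mtopology_is_euclidean)
    fix \<epsilon> :: real assume "\<epsilon> > 0"
    hence "\<forall>\<^sub>F n in sequentially. norm (xs n - x) * norm (ys n) + norm x * norm (ys n - y) < \<epsilon>"
      using order_tendstoD(2)[OF lim, of \<epsilon>] by simp
    thus "\<forall>\<^sub>F n in sequentially. \<forall>T\<in>topspace ?C. cinner (blinfun_apply T x) y \<in> UNIV \<and>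
        dist (cinner (blinfun_apply T (xs n)) (ys n)) (cinner (blinfun_apply T x) y) < \<epsilon>"
      by eventually_elim (use bound in \<open>auto intro: le_less_trans\<close>)
  qed simp
  thus ?thesis by (simp add: mtopology_is_euclidean)
qed

text \<open>
  The weak operator topology is given by uncountably many coefficients, so measurability of each of
  them would not suffice by itself. The basis coefficients alone induce the same topology on
  the unit ball, and they map into the second countable space of functions on \<open>nat \<times> nat\<close>.
\<close>

lemma measurable_wot_unit_ball:
  fixes e :: "nat \<Rightarrow> 'a::chilbert_space"
  assumes e: "onb e" and f: "\<And>z. z \<in> space M \<Longrightarrow> f z \<in> unit_ball_BH"
    and coeff: "\<And>i j. (\<lambda>z. cinner (blinfun_apply (f z) (e i)) (e j)) \<in> borel_measurable M"
  shows "f \<in> M \<rightarrow>\<^sub>M borel_of wot_unit_ball"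
  unfolding borel_of_def
proof (rule measurable_measure_of)
  let ?C = "pullback_topology unit_ball_BH (matrix_of e) euclidean"
  show "{U. openin wot_unit_ball U} \<subseteq> Pow (topspace wot_unit_ball)"
    by (auto dest: openin_subset)
  show "f \<in> space M \<rightarrow> topspace wot_unit_ball" using f by (simp add: topspace_wot)
  fix U :: "('a \<Rightarrow>\<^sub>L 'a) set" assume "U \<in> {U. openin wot_unit_ball U}"
  then obtain Q where Q: "open Q" "U = (\<lambda>T (x, y). cinner (blinfun_apply T x) y) -` Q \<inter> unit_ball_BH"
    by (auto simp: wot_unit_ball_def openin_pullback_topology)
  have "continuous_map ?C (product_topology (\<lambda>_. euclidean) UNIV) (\<lambda>T (x, y). cinner (blinfun_apply T x) y)"
    unfolding continuous_map_componentwise_UNIV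
    using continuous_map_matrix_coefficient[OF e] by (auto simp: split_beta)
  hence "openin ?C {T \<in> topspace ?C. (\<lambda>(x, y). cinner (blinfun_apply T x) y) \<in> Q}"
    unfolding euclidean_product_topology by (rule openin_continuous_map_preimage) (use Q in simp)
  moreover have "{T \<in> topspace ?C. (\<lambda>(x, y). cinner (blinfun_apply T x) y) \<in> Q} = U"
    by (auto simp: topspace_pullback_topology Q(2))
  ultimately obtain O' where O': "open O'" "U = matrix_of e -` O' \<inter> unit_ball_BH"
    by (auto simp: openin_pullback_topology)
  have "(\<lambda>z. matrix_of e (f z)) \<in> borel_measurable M"
    by (rule measurable_coordinatewise_then_product) (use coeff in \<open>auto simp: matrix_of_def split_beta\<close>)
  hence "(\<lambda>z. matrix_of e (f z)) -` O' \<inter> space M \<in> sets M"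
    using O'(1) by (simp add: measurable_sets)
  moreover have "f -` U \<inter> space M = (\<lambda>z. matrix_of e (f z)) -` O' \<inter> space M"
    using f by (auto simp: O'(2))
  ultimately show "f -` U \<inter> space M \<in> sets M" by simp
qed

section \<open>Evaluating polynomials is Borel\<close>

instance letter :: countable by countable_datatype

text \<open>A polynomial is determined by the finite graph of its coefficients on its support.\<close>

lemma countable_ncpoly: "countable (UNIV :: ncpoly set)"
proof -
  define Q where "Q = {z :: complex. Re z \<in> \<rat> \<and> Im z \<in> \<rat>}"
  define graph where "graph p = (\<lambda>w. (w, Poly_Mapping.lookup (coeffs p) w)) ` Poly_Mapping.keys (coeffs p)"
    for p :: ncpoly
  have "z \<in> (\<lambda>(a, b). Complex a b) ` (\<rat> \<times> \<rat>)" if "z \<in> Q" for z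
    by (rule image_eqI[of _ _ "(Re z, Im z)"]) (use that in \<open>auto simp: Q_def\<close>)
  hence "Q \<subseteq> (\<lambda>(a, b). Complex a b) ` (\<rat> \<times> \<rat>)" by blast
  hence Q: "countable Q"
    by (rule countable_subset) (intro countable_image countable_SIGMA countable_rat)
  have "inj graph"
  proof (rule injI)
    fix p q assume eq: "graph p = graph q"
    have lookup: "Poly_Mapping.lookup (coeffs r) w = c \<longleftrightarrow> (w, c) \<in> graph r \<or> c = 0 \<and> (\<forall>d. (w, d) \<notin> graph r)" for r w c
      by (auto simp: graph_def image_iff in_keys_iff)
    have "Poly_Mapping.lookup (coeffs p) w = Poly_Mapping.lookup (coeffs q) w" for w
      unfolding lookup[of p] eq by (simp flip: lookup)
    hence "coeffs p = coeffs q" by (rule poly_mapping_eqI)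
    thus "p = q" by (simp add: coeffs_inject)
  qed
  moreover have "graph p \<in> {S. S \<subseteq> UNIV \<times> Q \<and> finite S}" for p
    using coeffs[of p] by (auto simp: graph_def Q_def)
  hence "range graph \<subseteq> {S. S \<subseteq> UNIV \<times> Q \<and> finite S}" by blast
  moreover have "countable {S :: (letter list \<times> complex) set. finite S \<and> S \<subseteq> UNIV \<times> Q}"
    by (intro countable_Collect_finite_subset countable_SIGMA Q countableI_type)
  ultimately show ?thesis
    by (metis (no_types, lifting) Collect_cong countable_image_inj_eq countable_subset)
qed

lemma Gamma_unit_ball: "\<gamma> \<in> space Gamma_space \<Longrightarrow> \<gamma> k \<in> unit_ball_BH"
  by (auto simp: Gamma_space_def space_restrict_space space_PiM space_borel_of topspace_wot)

lemma Gamma_BH: "\<gamma> \<in> space Gamma_space \<Longrightarrow> range \<gamma> \<subseteq> BH"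
  using Gamma_unit_ball by (auto simp: unit_ball_BH_def)

lemma measurable_generator:
  "(\<lambda>\<gamma>. cinner (blinfun_apply (\<gamma> k) x) y) \<in> borel_measurable Gamma_space"
proof -
  have "(\<lambda>\<gamma>. \<gamma> k) \<in> (\<Pi>\<^sub>M n\<in>UNIV. borel_of wot_unit_ball) \<rightarrow>\<^sub>M borel_of wot_unit_ball"
    by (rule measurable_component_singleton) simp
  from measurable_compose[OF this measurable_matrix_coefficient] show ?thesis
    unfolding Gamma_space_def by (rule measurable_restrict_space1)
qed

lemma measurable_eval_letter:
  "(\<lambda>\<gamma>. cinner (blinfun_apply (eval_letter \<gamma> l) x) y) \<in> borel_measurable Gamma_space"
proof (cases l)
  case (StarVar k)
  have "(\<lambda>\<gamma>. cnj (cinner (blinfun_apply (\<gamma> k) y) x)) \<in> borel_measurable Gamma_space"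
    by (intro measurable_compose[OF measurable_generator] borel_measurable_continuous_onI continuous_intros)
  moreover have "cnj (cinner (blinfun_apply (\<gamma> k) y) x) = cinner (blinfun_apply (eval_letter \<gamma> l) x) y"
    if "\<gamma> \<in> space Gamma_space" for \<gamma>
    using Gamma_BH[OF that] StarVar by (simp add: cinner_adj_left range_subsetD flip: cinner_commute)
  ultimately show ?thesis by (simp cong: measurable_cong)
qed (simp add: measurable_generator)

lemma eval_letter_in_BH: "\<gamma> \<in> space Gamma_space \<Longrightarrow> eval_letter \<gamma> l \<in> BH"
  using Gamma_BH[of \<gamma>] by (cases l) (auto intro!: adj_in_BH)

text \<open>
  Multiplication is not jointly continuous for the weak operator topology; it is Borel because the
  coefficients of \<open>S T\<close> are the matrix products \<open>\<Sum>i. \<langle>T x, e i\<rangle> \<langle>S (e i), y\<rangle>\<close>.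
\<close>

lemma measurable_eval_word:
  assumes e: "onb (e :: nat \<Rightarrow> 'h::chilbert_space)"
  shows "(\<lambda>\<gamma>. cinner (blinfun_apply (eval_word \<gamma> w) x) (y::'h)) \<in> borel_measurable Gamma_space"
proof (induction w arbitrary: x y)
  case Nil
  show ?case by (simp add: eval_word_def)
next
  case (Cons l w)
  show ?case
  proof (rule borel_measurable_LIMSEQ_metric)
    show "(\<lambda>\<gamma>. \<Sum>i<n. cinner (blinfun_apply (eval_word \<gamma> w) x) (e i) *
        cinner (blinfun_apply (eval_letter \<gamma> l) (e i)) y) \<in> borel_measurable Gamma_space" for n
      by (intro borel_measurable_sum borel_measurable_times Cons measurable_eval_letter)
    fix \<gamma> :: "nat \<Rightarrow> 'h \<Rightarrow>\<^sub>L 'h" assume "\<gamma> \<in> space Gamma_space"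
    hence l: "eval_letter \<gamma> l \<in> BH" by (rule eval_letter_in_BH)
    have "cnj (cinner (blinfun_apply (adj (eval_letter \<gamma> l)) y) (e i)) = cinner (blinfun_apply (eval_letter \<gamma> l) (e i)) y" for i
      by (simp add: cinner_adj_left[OF l] flip: cinner_commute)
    thus "(\<lambda>n. \<Sum>i<n. cinner (blinfun_apply (eval_word \<gamma> w) x) (e i) *
        cinner (blinfun_apply (eval_letter \<gamma> l) (e i)) y) \<longlonglongrightarrow> cinner (blinfun_apply (eval_word \<gamma> (l # w)) x) y"
      using onb_parseval[OF e, of "blinfun_apply (eval_word \<gamma> w) x" "blinfun_apply (adj (eval_letter \<gamma> l)) y"]
      by (simp add: cinner_adj_right[OF l] eval_word_def)
  qed
qed

lemma measurable_eval_poly: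
  assumes e: "onb (e :: nat \<Rightarrow> 'h::chilbert_space)"
  shows "(\<lambda>\<gamma>. cinner (blinfun_apply (eval_poly \<gamma> p) x) (y::'h)) \<in> borel_measurable Gamma_space"
proof -
  have "(\<lambda>\<gamma>. \<Sum>w\<in>Poly_Mapping.keys (coeffs p). Poly_Mapping.lookup (coeffs p) w *
      cinner (blinfun_apply (eval_word \<gamma> w) x) y) \<in> borel_measurable Gamma_space"
    by (intro borel_measurable_sum borel_measurable_times borel_measurable_const measurable_eval_word[OF e])
  thus ?thesis
    by (simp add: eval_poly_def blinfun.sum_left scaleC_op_apply cinner_sum_left cinner_scaleC_left)
qed

section \<open>The crossed product of a coded action\<close>

lemma group_table_simps [simp]:
  "carrier (table_group G) = UNIV" "m \<otimes>\<^bsub>table_group G\<^esub> k = G (m, k)"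
  by (simp_all add: table_group_def)

lemma coded_action_limit:
  assumes "(G, \<gamma>, \<Phi>) \<in> Act"
  shows "induces_hom \<gamma> \<gamma> (\<lambda>n. \<Phi> (m, n)) (coded_action \<gamma> \<Phi> m)"
  unfolding coded_action_def
  using assms by (intro induces_coded_hom Gamma_BH) (auto simp: Act_def action_code_def aut_code_def)

text \<open>
  The unit of the group may be any number, and a code does not prescribe how it acts. It acts
  trivially because its automorphism is idempotent and injective.
\<close>

lemma cstar_action_of_Act:
  assumes Act: "(G, \<gamma>, \<Phi>) \<in> Act"
  shows "cstar_action (table_group G) (Cstar \<gamma>) (coded_action \<gamma> \<Phi>)"
proof -
  interpret group "table_group G" using Act by (simp add: Act_def group_tables_def)
  have \<gamma>: "range \<gamma> \<subseteq> BH" using Act by (intro Gamma_BH) (simp add: Act_def)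
  have code: "action_code G \<gamma> \<Phi>" using Act by (simp add: Act_def)
  let ?\<alpha> = "coded_action \<gamma> \<Phi>"
  have hom: "star_hom (Cstar \<gamma>) (Cstar \<gamma>) (?\<alpha> g)" for g
    using coded_action_limit[OF Act] by (simp add: induces_hom_def)
  have action: "?\<alpha> g (?\<alpha> h a) = ?\<alpha> (g \<otimes>\<^bsub>table_group G\<^esub> h) a" if "a \<in> Cstar \<gamma>" for a g h
    using code that unfolding action_code_def by blast
  have bij: "bij_betw (?\<alpha> g) (Cstar \<gamma>) (Cstar \<gamma>)" for g
    using code by (simp add: action_code_def aut_code_def coded_action_def)
  have "?\<alpha> \<one>\<^bsub>table_group G\<^esub> a = a" if a: "a \<in> Cstar \<gamma>" for a
  proof -
    have "?\<alpha> \<one>\<^bsub>table_group G\<^esub> (?\<alpha> \<one>\<^bsub>table_group G\<^esub> a) = ?\<alpha> \<one>\<^bsub>table_group G\<^esub> a"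
      using action[OF a] by (metis l_one one_closed)
    thus ?thesis
      using bij[of "\<one>\<^bsub>table_group G\<^esub>"] a star_hom_maps[OF hom a] by (auto simp: bij_betw_def inj_on_eq_iff)
  qed
  thus ?thesis
    using hom action cstar_subalgebra_Cstar[OF \<gamma>] by unfold_locales auto
qed

context cstar_action
begin

lemma term_op_coefficient:
  assumes "a \<in> A"
  shows "cinner (blinfun_apply (term_op (\<alpha> h a) g) (ell2_single p x)) (ell2_single q y) =
    (if g \<otimes> p = q then cinner (blinfun_apply (\<alpha> (inv q \<otimes> h) a) x) y else 0)"
proof -
  have "inv g \<otimes> q = p \<longleftrightarrow> g \<otimes> p = q" by (metis inv_mult_cancel)
  thus ?thesis
    by (simp add: cinner_ell2_single term_op_def coord_reg_rep coord_left_translation coord_ell2_single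
        assms action_in action)
qed

end


section \<open>The Borel map\<close>

definition code_of_crossed_product ::
  "('h::chilbert_space ell2 \<Rightarrow>\<^sub>L 'h) \<Rightarrow> ('h \<Rightarrow>\<^sub>L 'h ell2) \<Rightarrow>
   (nat \<times> nat \<Rightarrow> nat) \<times> (nat \<Rightarrow> 'h \<Rightarrow>\<^sub>L 'h) \<times> (nat \<times> nat \<Rightarrow> ncpoly \<Rightarrow> ncpoly) \<Rightarrow> nat \<Rightarrow> 'h \<Rightarrow>\<^sub>L 'h" where
  "code_of_crossed_product U V = (\<lambda>(G, \<gamma>, \<Phi>) n.
     conj_op U V (cstar_action.crossed_generators (table_group G) (coded_action \<gamma> \<Phi>) \<gamma> n))"

lemma code_of_crossed_product_isomorphic:
  assumes UV: "unitary_pair U V" and Act: "(G, \<gamma>, \<Phi>) \<in> Act"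
  shows "cstar_isomorphic (Cstar (code_of_crossed_product U V (G, \<gamma>, \<Phi>)))
    (reduced_crossed_product (Cstar \<gamma>) (coded_action \<gamma> \<Phi>) (table_group G))"
proof -
  interpret cstar_action "table_group G" "Cstar \<gamma>" "coded_action \<gamma> \<Phi>"
    by (rule cstar_action_of_Act[OF Act])
  show ?thesis
    using cstar_isomorphic_conj_op[OF UV Cstar_crossed_generators(2)[OF refl]]
    by (simp add: code_of_crossed_product_def Cstar_crossed_generators(1))
qed

text \<open>
  The generator for \<open>h = g = 1\<close> is \<open>\<pi>(\<gamma>\<^sub>k)\<close>, whose coordinate at the unit is \<open>\<gamma>\<^sub>k\<close>; so the code
  vanishes only if \<open>\<gamma>\<close> does.
\<close>

lemma code_of_crossed_product_in_Gamma:
  assumes UV: "unitary_pair U V" and Act: "(G, \<gamma>, \<Phi>) \<in> Act"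
  shows "code_of_crossed_product U V (G, \<gamma>, \<Phi>) n \<in> unit_ball_BH"
    and "code_of_crossed_product U V (G, \<gamma>, \<Phi>) \<noteq> (\<lambda>_. 0)"
proof -
  interpret cstar_action "table_group G" "Cstar \<gamma>" "coded_action \<gamma> \<Phi>"
    by (rule cstar_action_of_Act[OF Act])
  have \<Gamma>: "\<gamma> \<in> space Gamma_space" using Act by (simp add: Act_def)
  have \<gamma>: "\<gamma> k \<in> Cstar \<gamma>" "norm (\<gamma> k) \<le> 1" for k
    using Gamma_unit_ball[OF \<Gamma>] generator_in_Cstar by (auto simp: unit_ball_BH_def)
  obtain k h g where "prod_decode n = (k, prod_encode (h, g))"
    by (metis prod.exhaust prod_decode_inverse)
  hence "crossed_generators \<gamma> n = term_op (coded_action \<gamma> \<Phi> h (\<gamma> k)) g"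
    by (simp add: crossed_generators_def)
  moreover have "norm (term_op (coded_action \<gamma> \<Phi> h (\<gamma> k)) g) \<le> 1"
    using norm_term_op_le[OF action_in[OF \<gamma>(1)]] action_contractive[OF \<gamma>(1)] \<gamma>(2)
    by (meson order_trans)
  ultimately show "code_of_crossed_product U V (G, \<gamma>, \<Phi>) n \<in> unit_ball_BH"
    unfolding code_of_crossed_product_def unit_ball_BH_def
    using conj_op_in_BH[OF UV range_subsetD[OF Cstar_crossed_generators(2)[OF refl]], of n]
      order_trans[OF norm_conj_op_le[OF UV]] by simp
  show "code_of_crossed_product U V (G, \<gamma>, \<Phi>) \<noteq> (\<lambda>_. 0)"
  proof
    assume zero: "code_of_crossed_product U V (G, \<gamma>, \<Phi>) = (\<lambda>_. 0)"
    let ?e = "\<one>\<^bsub>table_group G\<^esub>"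
    have "\<gamma> k = 0" for k
    proof -
      have "conj_op U V (crossed_generators \<gamma> (prod_encode (k, prod_encode (?e, ?e)))) = 0"
        using fun_cong[OF zero] by (simp add: code_of_crossed_product_def)
      hence "conj_op V U (conj_op U V (crossed_generators \<gamma> (prod_encode (k, prod_encode (?e, ?e))))) = 0"
        by (simp only: conj_op_zero[OF unitary_pair_swap[OF UV]])
      hence "crossed_generators \<gamma> (prod_encode (k, prod_encode (?e, ?e))) = 0"
        by (simp only: conj_op_inverse[OF UV])
      hence "term_op (\<gamma> k) ?e = 0" by (simp add: crossed_generators_def action_one \<gamma>(1))
      hence "coord (blinfun_apply (term_op (\<gamma> k) ?e) (ell2_single ?e x)) ?e = 0" for x
        by (simp add: coord_zero)
      hence "blinfun_apply (\<gamma> k) x = 0" for x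
        by (simp add: term_op_def left_translation_one coord_reg_rep \<gamma>(1) action_one coord_ell2_single)
      thus ?thesis by (intro blinfun_eqI) simp
    qed
    hence "\<gamma> = (\<lambda>_. 0)" by (simp add: fun_eq_iff)
    thus False using \<Gamma> by (simp add: Gamma_space_def space_restrict_space)
  qed
qed

lemma measurable_table_entry:
  "(\<lambda>G. G (m, k)) \<in> group_table_space \<rightarrow>\<^sub>M count_space UNIV"
  unfolding group_table_space_def
  by (rule measurable_restrict_space1, rule measurable_component_singleton) simp

lemma measurable_code_entry:
  "(\<lambda>\<Phi>. \<Phi> (m, n) p) \<in> action_code_space \<rightarrow>\<^sub>M count_space UNIV"
proof -
  have 1: "(\<lambda>\<Phi>. \<Phi> (m, n)) \<in> action_code_space \<rightarrow>\<^sub>M (\<Pi>\<^sub>M p\<in>UNIV. count_space UNIV)"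
    unfolding action_code_space_def by (rule measurable_component_singleton) simp
  have 2: "(\<lambda>f. f p) \<in> (\<Pi>\<^sub>M p\<in>UNIV. count_space UNIV) \<rightarrow>\<^sub>M count_space (UNIV :: ncpoly set)" for p :: ncpoly
    by (rule measurable_component_singleton) simp
  show ?thesis by (rule measurable_compose[OF 1 2])
qed

text \<open>
  The matrix coefficients of the generators involve the group inverse only through an element
  \<open>m\<close> with \<open>q m = h\<close>, which a search through the multiplication table finds.
\<close>

lemma measurable_coded_coefficient:
  assumes e: "onb (e :: nat \<Rightarrow> 'h::chilbert_space)"
  shows "(\<lambda>(G, \<gamma>, \<Phi>). if G (g, p) = q
            then cinner (blinfun_apply (eval_poly \<gamma> (\<Phi> (LEAST m. G (q, m) = h, n) r)) x) (y::'h) else 0)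
         \<in> borel_measurable (group_table_space \<Otimes>\<^sub>M (Gamma_space \<Otimes>\<^sub>M action_code_space))"
proof -
  let ?M = "group_table_space \<Otimes>\<^sub>M (Gamma_space \<Otimes>\<^sub>M action_code_space)"
  have table: "(\<lambda>z. fst z (m, k)) \<in> ?M \<rightarrow>\<^sub>M count_space UNIV" for m k
    by (rule measurable_compose[OF measurable_fst measurable_table_entry])
  have gen: "(\<lambda>z. cinner (blinfun_apply (eval_poly (fst (snd z)) s) x) y) \<in> borel_measurable ?M" for s
    by (rule measurable_compose[OF measurable_compose[OF measurable_snd measurable_fst] measurable_eval_poly[OF e]])
  have code: "(\<lambda>z. snd (snd z) (m, n) r) \<in> ?M \<rightarrow>\<^sub>M count_space UNIV" for m
    by (rule measurable_compose[OF measurable_compose[OF measurable_snd measurable_snd] measurable_code_entry])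
  have fixed: "(\<lambda>z. cinner (blinfun_apply (eval_poly (fst (snd z)) (snd (snd z) (m, n) r)) x) y) \<in> borel_measurable ?M" for m
    by (rule measurable_compose_countable'[OF gen code countable_ncpoly])
  have pred: "Measurable.pred ?M (\<lambda>z. fst z (m, k) = l)" for m k l
    by (rule measurable_compose[OF table]) simp
  have least: "(\<lambda>z. LEAST m. fst z (q, m) = h) \<in> ?M \<rightarrow>\<^sub>M count_space UNIV"
    by (rule measurable_Least) (rule pred)
  have "(\<lambda>z. if fst z (g, p) = q then
      cinner (blinfun_apply (eval_poly (fst (snd z)) (snd (snd z) (LEAST m. fst z (q, m) = h, n) r)) x) y else 0)
      \<in> borel_measurable ?M"
    by (rule measurable_If[OF measurable_compose_countable[OF fixed least] measurable_const pred[unfolded pred_def]]) simp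
  thus ?thesis by (simp add: split_beta')
qed

text \<open>
  The indices \<open>i\<close> and \<open>j\<close> decode to a place in the group and a basis vector of \<open>H\<close> each. The
  corresponding coefficient vanishes unless \<open>g p = q\<close>, and then it belongs to the image of \<open>\<gamma> k\<close>
  under the group element \<open>q\<^sup>-\<^sup>1 h\<close>, which the code approximates by polynomials.
\<close>

lemma measurable_code_of_crossed_product:
  assumes e: "onb (e :: nat \<Rightarrow> 'h::chilbert_space)" and UV: "unitary_pair U V"
    and V: "\<And>i. blinfun_apply V (e i) = ell2_basis e i"
  shows "code_of_crossed_product U V \<in> Act_space \<rightarrow>\<^sub>M Gamma_space"
proof -
  have space: "space Act_space \<subseteq> Act" by (auto simp: Act_space_def space_restrict_space)
  have unit_ball: "code_of_crossed_product U V z n \<in> unit_ball_BH" if "z \<in> space Act_space" for z n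
    using code_of_crossed_product_in_Gamma(1)[OF UV] that space by (cases z) auto
  have nonzero: "code_of_crossed_product U V z \<noteq> (\<lambda>_. 0)" if "z \<in> space Act_space" for z
    using code_of_crossed_product_in_Gamma(2)[OF UV] that space by (cases z) auto
  have component: "(\<lambda>z. code_of_crossed_product U V z n) \<in> Act_space \<rightarrow>\<^sub>M borel_of wot_unit_ball" for n
  proof (rule measurable_wot_unit_ball[OF e])
    show "code_of_crossed_product U V z n \<in> unit_ball_BH" if "z \<in> space Act_space" for z
      by (rule unit_ball[OF that])
    fix i j
    obtain k h g where n: "prod_decode n = (k, prod_encode (h, g))"
      by (metis prod.exhaust prod_decode_inverse)
    obtain p b q d where ij: "prod_decode i = (p, b)" "prod_decode j = (q, d)" by fastforce
    let ?f = "\<lambda>t (G, \<gamma>, \<Phi>). if G (g, p) = q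
      then cinner (blinfun_apply (eval_poly \<gamma> (\<Phi> (LEAST m. G (q, m) = h, t) (var_poly k))) (e b)) (e d) else 0"
    show "(\<lambda>z. cinner (blinfun_apply (code_of_crossed_product U V z n) (e i)) (e j)) \<in> borel_measurable Act_space"
    proof (rule borel_measurable_LIMSEQ_metric)
      show "?f t \<in> borel_measurable Act_space" for t
        unfolding Act_space_def by (rule measurable_restrict_space1[OF measurable_coded_coefficient[OF e]])
      fix z :: "(nat \<times> nat \<Rightarrow> nat) \<times> (nat \<Rightarrow> 'h \<Rightarrow>\<^sub>L 'h) \<times> (nat \<times> nat \<Rightarrow> ncpoly \<Rightarrow> ncpoly)"
      assume z: "z \<in> space Act_space"
      obtain G \<gamma> \<Phi> where z_eq: "z = (G, \<gamma>, \<Phi>)" by (cases z)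
      have Act: "(G, \<gamma>, \<Phi>) \<in> Act" using z z_eq space by blast
      interpret cstar_action "table_group G" "Cstar \<gamma>" "coded_action \<gamma> \<Phi>"
        by (rule cstar_action_of_Act[OF Act])
      have quotient: "(LEAST m. G (q, m) = h) = G (inv\<^bsub>table_group G\<^esub> q, h)"
        using inv_mult_cancel[of q h] inv_mult_cancel(1)[of q]
        by (intro Least_equality) (auto simp: group_table_simps)
      have "cinner (blinfun_apply (code_of_crossed_product U V z n) (e i)) (e j)
          = cinner (blinfun_apply (term_op (coded_action \<gamma> \<Phi> h (\<gamma> k)) g) (ell2_single p (e b))) (ell2_single q (e d))"
        using UV by (simp add: z_eq code_of_crossed_product_def conj_op_apply unitary_pair_def V
            ell2_basis_def ij crossed_generators_def n)
      also have "\<dots> = (if G (g, p) = q then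
          cinner (blinfun_apply (coded_action \<gamma> \<Phi> (G (inv\<^bsub>table_group G\<^esub> q, h)) (\<gamma> k)) (e b)) (e d) else 0)"
        by (simp add: term_op_coefficient generator_in_Cstar)
      finally have eq: "cinner (blinfun_apply (code_of_crossed_product U V z n) (e i)) (e j) = \<dots>" .
      have "(\<lambda>t. eval_poly \<gamma> (\<Phi> (G (inv\<^bsub>table_group G\<^esub> q, h), t) (var_poly k)))
          \<longlonglongrightarrow> coded_action \<gamma> \<Phi> (G (inv\<^bsub>table_group G\<^esub> q, h)) (\<gamma> k)"
        using coded_action_limit[OF Act, of "G (inv\<^bsub>table_group G\<^esub> q, h)"]
        unfolding induces_hom_def by (elim conjE allE[of _ "var_poly k"]) (simp only: eval_var_poly)
      hence "(\<lambda>t. cinner (blinfun_apply (eval_poly \<gamma> (\<Phi> (G (inv\<^bsub>table_group G\<^esub> q, h), t) (var_poly k))) (e b)) (e d))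
          \<longlonglongrightarrow> cinner (blinfun_apply (coded_action \<gamma> \<Phi> (G (inv\<^bsub>table_group G\<^esub> q, h)) (\<gamma> k)) (e b)) (e d)"
        by (intro tendsto_cinner blinfun.tendsto tendsto_const)
      thus "(\<lambda>t. ?f t z) \<longlonglongrightarrow> cinner (blinfun_apply (code_of_crossed_product U V z n) (e i)) (e j)"
        unfolding eq by (simp add: z_eq quotient)
    qed
  qed
  have "(\<lambda>z n. code_of_crossed_product U V z n) \<in> Act_space \<rightarrow>\<^sub>M (\<Pi>\<^sub>M n\<in>UNIV. borel_of wot_unit_ball)"
    by (rule measurable_PiM_single'[OF component])
       (simp add: space_borel_of topspace_wot unit_ball PiE_UNIV_domain)
  moreover have "code_of_crossed_product U V \<in> space Act_space \<rightarrow> - {\<lambda>_. 0}"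
    using nonzero by simp
  ultimately show ?thesis
    unfolding Gamma_space_def by (intro measurable_restrict_space2)
qed

theorem proposition3p3p1:
  assumes "\<nexists>B. finite_dimensional_vector_space (scaleC :: complex \<Rightarrow> 'h::chilbert_space \<Rightarrow> 'h) B"
    and "separable_space (euclidean :: 'h topology)"
  shows "\<exists>\<delta> :: (nat \<times> nat \<Rightarrow> nat) \<times> (nat \<Rightarrow> 'h \<Rightarrow>\<^sub>L 'h) \<times> (nat \<times> nat \<Rightarrow> ncpoly \<Rightarrow> ncpoly)
                  \<Rightarrow> (nat \<Rightarrow> 'h \<Rightarrow>\<^sub>L 'h).
           \<delta> \<in> Act_space \<rightarrow>\<^sub>M Gamma_space \<and>
           (\<forall>(G, \<gamma>, \<Phi>)\<in>Act.
              cstar_isomorphic (Cstar (\<delta> (G, \<gamma>, \<Phi>)))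
                (reduced_crossed_product (Cstar \<gamma>) (coded_action \<gamma> \<Phi>) (table_group G)))"
proof -
  obtain e :: "nat \<Rightarrow> 'h" where e: "onb e" using onb_exists[OF assms] by blast
  obtain U :: "'h ell2 \<Rightarrow>\<^sub>L 'h" and V where UV: "unitary_pair U V"
    and V: "\<And>i. blinfun_apply V (e i) = ell2_basis e i"
    using unitary_pair_exists[OF e onb_ell2_basis[OF e]] by blast
  show ?thesis
    using measurable_code_of_crossed_product[OF e UV V] code_of_crossed_product_isomorphic[OF UV]
    by (intro exI[of _ "code_of_crossed_product U V"]) blast
qed

end
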